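(* There exist positive constants $c_*,\delta_*$ such that, for $0<\delta<\delta_*$, the following holds: for every integer $N\ge 0$, all real numbers $\lambda_0<\lambda_1<\cdots<\lambda_N$ satisfying $\lambda_{k+1}-\lambda_k\geq 1$ for $k=0,\ldots,N-1$, and all complex numbers $a_0,\ldots,a_N$, $$\sum_{k=0}^{N}\frac{|a_k|}{k+1}\leq \frac{c_*}{\delta^{15/2}}\int_{-\frac{1+\delta}{2}}^{\frac{1+\delta}{2}}\left|\sum_{k=0}^{N}a_k e^{2i\pi\lambda_k t}\right|\,\mathrm{d}t.$$
   Context: The constants $c_*,\delta_*$ are absolute: they do not depend on $\delta$, $N$, $(\lambda_k)$ or $(a_k)$. *)

theory Defs
  imports "HOL-Analysis.Analysis"
begin

end

theory Submission
  imports Defs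
begin

text \<open>
  This is Nazarov's extension of the Littlewood conjecture (McGehee, Pigno, Smith) to frequencies
  with gaps at least one, on an interval of length \<open>L = 1 + \<delta>\<close> barely longer than the critical
  length one. The proof is by duality: it builds a function \<open>F\<close>, bounded by a multiple of
  \<open>1 / \<delta>\<close> on the interval, whose pairing with \<open>f = \<Sum> a\<^sub>k e(\<lambda>\<^sub>k t)\<close> against the weight
  \<open>cos (\<pi> t / L)\<close> has real part at least a multiple of
  \<open>\<delta> \<Sum> |a\<^sub>k| / (k + Q)\<close>, with \<open>Q\<close> a square of size \<open>\<delta>\<^sup>-\<^sup>2\<close>.

  The exponentials are not orthogonal, but the transform of the weight is explicit, and Ingham's
  observation is that the off-diagonal part of each row of its Gram matrix sums to less than the
  diagonal entry, with a margin proportional to \<open>\<delta>\<close>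
  (\<open>norm_window_ft_le\<close>, \<open>weighted_row_sum_le\<close>). So the first candidate for \<open>F\<close>,
  namely \<open>\<Sum> w\<^sub>k e(\<lambda>\<^sub>k t)\<close> with \<open>w\<^sub>k = sgn a\<^sub>k / (k + Q)\<close>, already pairs well with \<open>f\<close>
  without inverting the matrix. The shift \<open>Q\<close> makes the weights \<open>1 / (k + Q)\<close> vary so slowly
  that inserting them in the row sums costs only part of the margin; going back to \<open>1 / (k + 1)\<close>
  costs a factor \<open>Q\<close>. Altogether this gives a bound of order \<open>\<delta>\<^sup>-\<^sup>4\<close>, which is better than
  \<open>\<delta>\<close> to the power \<open>-15/2\<close>.

  That candidate is not bounded uniformly in \<open>N\<close>, which the construction of McGehee, Pigno and Smith
  repairs. Cut it into
  blocks \<open>f\<^sub>j\<close> on which \<open>k + Q\<close> grows by a factor four. Each block is bounded by \<open>3\<close> and has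
  mean square of order at most \<open>4\<^sup>-\<^sup>j / Q\<close> (\<open>exponential_sum_l2_bound\<close>). Choose \<open>h\<^sub>j\<close> with
  \<open>Re h\<^sub>j\<close> slightly above \<open>|f\<^sub>j|\<close>, with comparable mean square, and with spectrum on one side
  only (\<open>one_sided_majorant\<close>, \<open>one_sided_l2_le_real_part\<close>), and replace \<open>f\<^sub>j\<close> by
  \<open>f\<^sub>j exp (- \<epsilon> \<Sum>\<^sub>i\<^sub>>\<^sub>j h\<^sub>i)\<close>. The damping keeps the sum bounded by \<open>2 / \<epsilon>\<close>
  (\<open>corrected_sum_bounded\<close>). The changes it makes to the pairing at \<open>\<lambda>\<^sub>k\<close> are at most a
  multiple of \<open>\<epsilon> / (k + Q)\<close>: blocks near or beyond that of \<open>k\<close> are small in mean square, and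
  for blocks far below it the one-sided spectrum, which points away from \<open>\<lambda>\<^sub>k\<close>, meets only the tail of
  the transform of the weight (\<open>one_sided_pairing\<close>). With \<open>\<epsilon>\<close> a small multiple of \<open>\<delta>\<close>
  these changes are absorbed by the margin.
\<close>

section \<open>The cosine window and its Gram matrix\<close>

abbreviation e1 :: "real \<Rightarrow> complex" where "e1 x \<equiv> cis (2 * pi * x)"

definition window_ft :: "real \<Rightarrow> real \<Rightarrow> complex" where
  "window_ft L \<xi> = integral {-L/2..L/2} (\<lambda>t. of_real (cos (pi * t / L)) * e1 (\<xi> * t))"

lemma integral_of_real_on:
  fixes f :: "real \<Rightarrow> real"
  assumes "f integrable_on A"
  shows "integral A (\<lambda>x. complex_of_real (f x)) = of_real (integral A f)"
  using assms by (intro integral_unique has_integral_of_real integrable_integral)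

text \<open>
  An antiderivative of \<open>cos (\<alpha> t) exp (\<i> \<omega> t)\<close> is
  \<open>exp (\<i> \<omega> t) (\<i> \<omega> cos (\<alpha> t) + \<alpha> sin (\<alpha> t)) / (\<alpha>\<^sup>2 - \<omega>\<^sup>2)\<close>; at the end points of the
  window the cosine vanishes, so the transform decays quadratically. The excluded frequencies
  are the resonances \<open>\<omega> = \<plusminus>\<alpha>\<close>.
\<close>
lemma window_ft_has_integral:
  fixes L \<xi> :: real
  assumes "L > 0" "(2 * L * \<xi>)\<^sup>2 \<noteq> 1"
  shows "((\<lambda>t. of_real (cos (pi * t / L)) * e1 (\<xi> * t)) has_integral
      of_real (2 * L * cos (pi * L * \<xi>) / (pi * (1 - (2 * L * \<xi>)\<^sup>2)))) {-L/2..L/2}"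
proof -
  define \<omega> where "\<omega> = 2 * pi * \<xi>"
  define \<alpha> where "\<alpha> = pi / L"
  define D where "D = \<alpha>\<^sup>2 - \<omega>\<^sup>2"
  have Deq: "D = (pi / L)\<^sup>2 * (1 - (2 * L * \<xi>)\<^sup>2)"
    using assms(1) by (simp add: D_def \<alpha>_def \<omega>_def field_simps power2_eq_square)
  have D0: "D \<noteq> 0" unfolding Deq using assms by simp
  define G :: "real \<Rightarrow> complex" where
    "G t = cis (\<omega> * t) * (\<i> * of_real (\<omega> * cos (\<alpha> * t)) + of_real (\<alpha> * sin (\<alpha> * t))) / of_real D" for t
  have der: "(G has_vector_derivative of_real (cos (pi * t / L)) * e1 (\<xi> * t)) (at t within {-L/2..L/2})" for t
  proof -
    have "(G has_vector_derivative
       ((\<omega> *\<^sub>R (\<i> * cis (\<omega> * t))) * (\<i> * of_real (\<omega> * cos (\<alpha> * t)) + of_real (\<alpha> * sin (\<alpha> * t))) +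
         cis (\<omega> * t) * (\<i> * of_real (- \<omega> * \<alpha> * sin (\<alpha> * t)) + of_real (\<alpha> * \<alpha> * cos (\<alpha> * t)))) / of_real D)
         (at t within {-L/2..L/2})"
      unfolding G_def has_vector_derivative_def
      by (rule derivative_eq_intros refl | simp add: fun_eq_iff D0 | simp add: field_simps scaleR_conv_of_real D0)+
    moreover have "((\<omega> *\<^sub>R (\<i> * cis (\<omega> * t))) * (\<i> * of_real (\<omega> * cos (\<alpha> * t)) + of_real (\<alpha> * sin (\<alpha> * t))) +
         cis (\<omega> * t) * (\<i> * of_real (- \<omega> * \<alpha> * sin (\<alpha> * t)) + of_real (\<alpha> * \<alpha> * cos (\<alpha> * t))))
        = of_real D * (of_real (cos (\<alpha> * t)) * cis (\<omega> * t))"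
      by (simp add: D_def scaleR_conv_of_real algebra_simps power2_eq_square)
    ultimately show ?thesis using D0
      by (simp add: \<omega>_def \<alpha>_def mult_ac)
  qed
  have "((\<lambda>t. of_real (cos (pi * t / L)) * e1 (\<xi> * t)) has_integral (G (L/2) - G (-L/2))) {-L/2..L/2}"
    by (rule fundamental_theorem_of_calculus) (use assms der in auto)
  moreover have "G (L/2) - G (-L/2) = of_real (2 * L * cos (pi * L * \<xi>) / (pi * (1 - (2 * L * \<xi>)\<^sup>2)))"
  proof -
    have "\<alpha> * (L/2) = pi/2" using assms by (simp add: \<alpha>_def)
    moreover have "\<alpha> * (-L/2) = -(pi/2)" using assms by (simp add: \<alpha>_def)
    ultimately have "G (L/2) - G (-L/2) = of_real \<alpha> * (cis (\<omega> * (L/2)) + cis (-(\<omega> * (L/2)))) / of_real D"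
      unfolding G_def by (simp add: add_divide_distrib algebra_simps)
    also have "cis (\<omega> * (L/2)) + cis (-(\<omega> * (L/2))) = of_real (2 * cos (pi * L * \<xi>))"
      by (simp add: complex_eq_iff \<omega>_def mult_ac)
    also have "of_real \<alpha> * of_real (2 * cos (pi * L * \<xi>)) / of_real D
        = (of_real (2 * L * cos (pi * L * \<xi>) / (pi * (1 - (2 * L * \<xi>)\<^sup>2))) :: complex)"
    proof -
      have "\<alpha> * (2 * cos (pi * L * \<xi>)) / D = 2 * L * cos (pi * L * \<xi>) / (pi * (1 - (2 * L * \<xi>)\<^sup>2))"
        unfolding Deq \<alpha>_def using assms by (simp add: field_simps power2_eq_square)
      thus ?thesis by (metis of_real_mult of_real_divide)
    qed
    finally show ?thesis .
  qed
  ultimately show ?thesis by simp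
qed

lemma window_ft_eq:
  assumes "L > 0" "(2 * L * \<xi>)\<^sup>2 \<noteq> 1"
  shows "window_ft L \<xi> = of_real (2 * L * cos (pi * L * \<xi>) / (pi * (1 - (2 * L * \<xi>)\<^sup>2)))"
  unfolding window_ft_def by (rule integral_unique) (rule window_ft_has_integral[OF assms])

lemma window_ft_0: "L > 0 \<Longrightarrow> window_ft L 0 = of_real (2 * L / pi)"
  by (subst window_ft_eq) auto

text \<open>
  Compared with the diagonal entry \<open>2 L / \<pi>\<close>, the bounds for \<open>x = 1, 2, \<dots>\<close> counted on both sides
  sum to \<open>2 / (\<pi> L)\<close>. The two values agree at \<open>L = 1\<close>, so these bounds give
  diagonal dominance exactly beyond the critical length, with margin \<open>(2 / \<pi>) (L - 1 / L)\<close>.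
\<close>
lemma norm_window_ft_le:
  assumes "L \<ge> 1" "x \<ge> 1" "x \<le> \<bar>\<xi>\<bar>"
  shows "norm (window_ft L \<xi>) \<le> 2 / (pi * L) * (1 / (4 * x\<^sup>2 - 1))"
proof -
  have x2: "x\<^sup>2 \<le> \<xi>\<^sup>2" "1 \<le> x\<^sup>2" using assms by (auto simp: abs_le_square_iff[symmetric])
  have L2: "1 \<le> L\<^sup>2" using assms by simp
  have a: "L\<^sup>2 * (4 * x\<^sup>2 - 1) \<le> (2 * L * \<xi>)\<^sup>2 - 1"
  proof -
    have "L\<^sup>2 * x\<^sup>2 \<le> L\<^sup>2 * \<xi>\<^sup>2" using x2 by (intro mult_left_mono) auto
    thus ?thesis using L2 by (simp add: power_mult_distrib algebra_simps)
  qed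
  have pos: "L\<^sup>2 * (4 * x\<^sup>2 - 1) > 0" using x2 L2 by (intro mult_pos_pos) auto
  have "norm (window_ft L \<xi>) = \<bar>2 * L * cos (pi * L * \<xi>) / (pi * (1 - (2 * L * \<xi>)\<^sup>2))\<bar>"
  proof -
    have nz: "(2 * L * \<xi>)\<^sup>2 \<noteq> 1" using a pos by linarith
    have "L > 0" using assms(1) by simp
    from window_ft_eq[OF this nz] show ?thesis by (simp only: norm_of_real)
  qed
  also have "\<dots> = 2 * L * \<bar>cos (pi * L * \<xi>)\<bar> / (pi * ((2 * L * \<xi>)\<^sup>2 - 1))"
    using assms a pos by (simp add: abs_mult abs_minus_commute)
  also have "\<dots> \<le> 2 * L * 1 / (pi * (L\<^sup>2 * (4 * x\<^sup>2 - 1)))"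
  proof -
    have "0 < 4 * x\<^sup>2 - 1" using x2(2) by linarith
    with assms a pos show ?thesis by (intro frac_le mult_left_mono mult_pos_pos) auto
  qed
  also have "\<dots> = 2 / (pi * L) * (1 / (4 * x\<^sup>2 - 1))"
    using assms by (simp add: power2_eq_square)
  finally show ?thesis .
qed

lemma sum_inverse_4_squares_minus_1_le: "(\<Sum>n=1..m. 1 / (4 * (real n)\<^sup>2 - 1)) \<le> 1 / 2"
proof -
  have "(\<Sum>n=1..m. 1 / (4 * (real n)\<^sup>2 - 1)) = 1/2 - 1 / (2 * (2 * real m + 1))"
  proof (induction m)
    case (Suc m)
    have nz: "4 * (real (Suc m))\<^sup>2 - 1 = (2 * real m + 1) * (2 * real m + 3)"
      by (simp add: power2_eq_square algebra_simps)
    have *: "1 / ((2 * x + 1) * (2 * x + 3)) = 1 / (2 * (2 * x + 1)) - 1 / (2 * (2 * x + 3))"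
      if "x \<ge> 0" for x :: real using that by (simp add: divide_simps) (simp add: algebra_simps)
    have "2 * (2 * real (Suc m) + 1) = 2 * (2 * real m + 3)" by simp
    with Suc *[of "real m"] show ?case by (simp add: nz del: of_nat_Suc)
  qed simp
  thus ?thesis by simp
qed

lemma sum_off_diagonal:
  fixes g :: "nat \<Rightarrow> real"
  assumes "k \<le> N"
  shows "(\<Sum>l\<in>{..N}-{k}. g l) = (\<Sum>n=1..k. g (k - n)) + (\<Sum>n=1..N-k. g (k + n))"
proof -
  have "{..N}-{k} = {..<k} \<union> {k<..N}" using assms by auto
  moreover have "sum g ({..<k} \<union> {k<..N}) = sum g {..<k} + sum g {k<..N}"
    by (rule sum.union_disjoint) auto
  moreover have "sum g {..<k} = (\<Sum>n=1..k. g (k - n))"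
    by (rule sum.reindex_bij_witness[of _ "\<lambda>n. k - n" "\<lambda>n. k - n"]) auto
  moreover have "sum g {k<..N} = (\<Sum>n=1..N-k. g (k + n))"
    by (rule sum.reindex_bij_witness[of _ "\<lambda>n. k + n" "\<lambda>n. n - k"]) auto
  ultimately show ?thesis by simp
qed

text \<open>
  Comparison with the telescoping sum of \<open>1 / (x - 1/2) - 1 / (x + 1/2) = 1 / (x\<^sup>2 - 1/4)\<close>.
\<close>
lemma sum_inverse_squares_le:
  fixes a :: real
  assumes "a \<ge> 1"
  shows "(\<Sum>n<m. 1 / (a + real n)\<^sup>2) \<le> 2 / a"
proof -
  have step: "1 / x\<^sup>2 \<le> 1 / (x - 1/2) - 1 / (x + 1/2)" if "x \<ge> 1" for x :: real
  proof -
    have "1 / x\<^sup>2 \<le> 1 / (x\<^sup>2 - 1/4)"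
    proof (intro divide_left_mono mult_pos_pos)
      have "x\<^sup>2 \<ge> 1" using that by simp
      thus "0 < x\<^sup>2 - 1/4" "0 < x\<^sup>2" by linarith+
    qed auto
    also have "\<dots> = 1 / (x - 1/2) - 1 / (x + 1/2)"
    proof -
      have "(x - 1/2) * (x + 1/2) = x\<^sup>2 - 1/4" by (simp add: power2_eq_square algebra_simps)
      thus ?thesis using that by (subst diff_frac_eq) (auto simp del: times_divide_eq_left times_divide_eq_right)
    qed
    finally show ?thesis .
  qed
  have "(\<Sum>n<m. 1 / (a + real n)\<^sup>2) \<le> 1 / (a - 1/2) - 1 / (a + real m - 1/2)"
  proof (induction m)
    case (Suc m)
    show ?case using step[of "a + real m"] assms Suc by (simp add: algebra_simps)
  qed simp
  also have "\<dots> \<le> 1 / (a - 1/2)" using assms by simp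
  also have "\<dots> \<le> 2 / a" using assms by (simp add: field_simps)
  finally show ?thesis .
qed

text \<open>
  Above the diagonal the weights only help. Below it, at distance \<open>n\<close>, with \<open>y = k - n + Q\<close>,
  the relative excess of the weight is \<open>n / y\<close>, which combines with \<open>1 / (4 n\<^sup>2 - 1)\<close> to at most
  \<open>1 / (3 n y)\<close>. By the inequality \<open>2 / (n y) \<le> 1 / (R n\<^sup>2) + R / y\<^sup>2\<close>, whose parameter \<open>R\<close>
  balances the two sums, the excess is of order \<open>1 / R = 1 / \<surd>Q\<close>.
\<close>
lemma weighted_row_sum_le:
  fixes R k N :: nat and Q :: real
  assumes "R \<ge> 1" "k \<le> N" and Q: "Q = (real R)\<^sup>2"
  shows "(\<Sum>l\<in>{..N}-{k}. 1 / (4 * (real k - real l)\<^sup>2 - 1) * (1 / (real l + Q)))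
    \<le> (1 + 2 / (3 * real R)) / (real k + Q)"
proof -
  have Q1: "Q \<ge> 1" using assms by simp
  have R1: "real R \<ge> 1" using assms by simp
  have den: "4 * (real n)\<^sup>2 - 1 \<ge> 3 * (real n)\<^sup>2" "3 * (real n)\<^sup>2 > 0" if "n \<ge> 1" for n :: nat
    using that one_le_power[of "real n" 2] by (auto simp: )
  have up: "(\<Sum>n=1..N-k. 1 / (4 * (real k - real (k+n))\<^sup>2 - 1) * (1 / (real (k+n) + Q)))
     \<le> (1/2) * (1 / (real k + Q))"
  proof -
    have "(\<Sum>n=1..N-k. 1 / (4 * (real k - real (k+n))\<^sup>2 - 1) * (1 / (real (k+n) + Q)))
       \<le> (\<Sum>n=1..N-k. 1 / (4 * (real n)\<^sup>2 - 1) * (1 / (real k + Q)))"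
    proof (intro sum_mono)
      fix n assume "n \<in> {1..N-k}"
      hence "n \<ge> 1" by simp
      from den[OF this] have "0 < 4 * (real n)\<^sup>2 - 1" by linarith
      moreover have "1 / (real (k+n) + Q) \<le> 1 / (real k + Q)"
        using Q1 by (intro divide_left_mono mult_pos_pos) auto
      ultimately have "1 / (4 * (real n)\<^sup>2 - 1) * (1 / (real (k+n) + Q))
         \<le> 1 / (4 * (real n)\<^sup>2 - 1) * (1 / (real k + Q))"
        by (intro mult_left_mono) auto
      thus "1 / (4 * (real k - real (k+n))\<^sup>2 - 1) * (1 / (real (k+n) + Q))
         \<le> 1 / (4 * (real n)\<^sup>2 - 1) * (1 / (real k + Q))" by simp
    qed
    also have "\<dots> \<le> (1/2) * (1 / (real k + Q))"
      unfolding sum_distrib_right[symmetric] using Q1 by (intro mult_right_mono sum_inverse_4_squares_minus_1_le) auto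
    finally show ?thesis .
  qed
  have term_le: "1 / (4 * (real k - real (k-n))\<^sup>2 - 1) * (1 / (real (k-n) + Q))
      \<le> (1 / (real k + Q)) * (1 / (4 * (real n)\<^sup>2 - 1)
           + (1/6) * ((1 / real R) * (1 / (real n)\<^sup>2) + real R * (1 / (real (k-n) + Q)\<^sup>2)))"
    if n: "n \<in> {1..k}" for n
  proof -
    define y where "y = real (k-n) + Q"
    define x where "x = real n"
    have x1: "x \<ge> 1" using n by (simp add: x_def)
    have y0: "y > 0" using Q1 by (simp add: y_def)
    have xy: "real k + Q = x + y" "real k - real (k-n) = x" using n by (auto simp: x_def y_def of_nat_diff)
    have d: "4 * x\<^sup>2 - 1 \<ge> 3 * x\<^sup>2" "3 * x\<^sup>2 > 0" using den[of n] n by (auto simp: x_def)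
    have "1 / (4 * x\<^sup>2 - 1) * (1 / y) = (1 / (x + y)) * (1 / (4 * x\<^sup>2 - 1) * (1 + x / y))"
      using x1 y0 by (simp add: field_simps)
    also have "\<dots> = (1 / (x + y)) * (1 / (4 * x\<^sup>2 - 1) + 1 / (4 * x\<^sup>2 - 1) * (x / y))"
      by (simp add: distrib_left)
    also have "\<dots> \<le> (1 / (x + y)) * (1 / (4 * x\<^sup>2 - 1)
           + (1/6) * ((1 / real R) * (1 / x\<^sup>2) + real R * (1 / y\<^sup>2)))"
    proof (intro mult_left_mono add_left_mono)
      have "1 / (4 * x\<^sup>2 - 1) * (x / y) \<le> 1 / (3 * x\<^sup>2) * (x / y)"
      proof -
        have "0 < 4 * x\<^sup>2 - 1" using d by linarith
        with x1 y0 d show ?thesis by (intro mult_right_mono divide_left_mono mult_pos_pos) auto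
      qed
      also have "\<dots> = (1/3) * ((1/x) * (1/y))" using x1 by (simp add: power2_eq_square)
      also have "(1/x) * (1/y) \<le> (1/2) * ((1 / real R) * (1 / x\<^sup>2) + real R * (1 / y\<^sup>2))"
      proof -
        have "0 \<le> (1 / real R) * (1/x - real R / y)\<^sup>2" by simp
        also have "\<dots> = (1 / real R) * (1 / x\<^sup>2) + real R * (1 / y\<^sup>2) - 2 * ((1/x) * (1/y))"
          using R1 by (simp add: power2_eq_square algebra_simps)
        finally show ?thesis by simp
      qed
      finally show "1 / (4 * x\<^sup>2 - 1) * (x / y)
          \<le> (1/6) * ((1 / real R) * (1 / x\<^sup>2) + real R * (1 / y\<^sup>2))" by simp
    qed (use x1 y0 in auto)
    finally show ?thesis unfolding xy y_def[symmetric] x_def[symmetric] .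
  qed
  have s1: "(\<Sum>n=1..k. 1 / (real n)\<^sup>2) \<le> 2"
  proof -
    have "(\<Sum>n=1..k. 1 / (real n)\<^sup>2) = (\<Sum>n<k. 1 / (1 + real n)\<^sup>2)"
      by (rule sum.reindex_bij_witness[of _ Suc "\<lambda>n. n - 1"]) auto
    thus ?thesis using sum_inverse_squares_le[of 1 k] by simp
  qed
  have s2: "(\<Sum>n=1..k. 1 / (real (k-n) + Q)\<^sup>2) \<le> 2 / Q"
  proof -
    have "(\<Sum>n=1..k. 1 / (real (k-n) + Q)\<^sup>2) = (\<Sum>n<k. 1 / (Q + real n)\<^sup>2)"
      by (rule sum.reindex_bij_witness[of _ "\<lambda>n. k - n" "\<lambda>n. k - n"]) (auto simp: add_ac)
    thus ?thesis using sum_inverse_squares_le[of Q k] Q1 by simp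
  qed
  have "(\<Sum>n=1..k. 1 / (4 * (real k - real (k-n))\<^sup>2 - 1) * (1 / (real (k-n) + Q)))
     \<le> (\<Sum>n=1..k. (1 / (real k + Q)) * (1 / (4 * (real n)\<^sup>2 - 1)
           + (1/6) * ((1 / real R) * (1 / (real n)\<^sup>2) + real R * (1 / (real (k-n) + Q)\<^sup>2))))"
    by (intro sum_mono term_le)
  also have "\<dots> = (1 / (real k + Q)) * ((\<Sum>n=1..k. 1 / (4 * (real n)\<^sup>2 - 1))
           + (1/6) * ((1 / real R) * (\<Sum>n=1..k. 1 / (real n)\<^sup>2) + real R * (\<Sum>n=1..k. 1 / (real (k-n) + Q)\<^sup>2)))"
    by (simp only: sum.distrib flip: sum_distrib_left)
  also have "\<dots> \<le> (1 / (real k + Q)) * (1/2 + (1/6) * ((1 / real R) * 2 + real R * (2 / Q)))"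
    using Q1 by (intro mult_left_mono add_mono sum_inverse_4_squares_minus_1_le s1 s2) auto
  also have "\<dots> = (1 / (real k + Q)) * (1/2 + 2 / (3 * real R))"
    using R1 by (simp add: Q power2_eq_square)
  finally have down: "(\<Sum>n=1..k. 1 / (4 * (real k - real (k-n))\<^sup>2 - 1) * (1 / (real (k-n) + Q)))
     \<le> (1 / (real k + Q)) * (1/2 + 2 / (3 * real R))" .
  have "(1 / (real k + Q)) * (1/2 + 2 / (3 * real R)) + (1/2) * (1 / (real k + Q))
      = (1 + 2 / (3 * real R)) / (real k + Q)"
  proof -
    have "(1 / y) * (1/2 + c) + (1/2) * (1 / y) = (1 + c) / y" if "y > 0" for y c :: real
      using that by (simp add: divide_simps)
    from this[of "real k + Q"] show ?thesis using Q1 by (simp del: times_divide_eq_left times_divide_eq_right)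
  qed
  with add_mono[OF down up] show ?thesis
    unfolding sum_off_diagonal[OF assms(2)] by linarith
qed

lemma row_sum_le:
  fixes k N :: nat
  assumes "k \<le> N"
  shows "(\<Sum>l\<in>{..N}-{k}. 1 / (4 * (real k - real l)\<^sup>2 - 1)) \<le> 1"
proof -
  have "(\<Sum>n=1..k. 1 / (4 * (real k - real (k-n))\<^sup>2 - 1)) = (\<Sum>n=1..k. 1 / (4 * (real n)\<^sup>2 - 1))"
    by (intro sum.cong) (auto simp: of_nat_diff)
  thus ?thesis unfolding sum_off_diagonal[OF assms]
    using sum_inverse_4_squares_minus_1_le[of k] sum_inverse_4_squares_minus_1_le[of "N-k"] by simp
qed

lemma gram_expansion:
  fixes N :: nat
  assumes "L > 0"
  shows "integral {-L/2..L/2} (\<lambda>t. of_real (cos (pi * t / L)) *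
      ((\<Sum>k\<le>N. b k * e1 (lam k * t)) * e1 (\<mu> * t)))
    = (\<Sum>k\<le>N. b k * window_ft L (lam k + \<mu>))"
proof -
  have e: "e1 ((lam k + \<mu>) * t) = e1 (lam k * t) * e1 (\<mu> * t)" for k t
    by (simp add: cis_mult distrib_left distrib_right)
  have "integral {-L/2..L/2} (\<lambda>t. of_real (cos (pi * t / L)) *
      ((\<Sum>k\<le>N. b k * e1 (lam k * t)) * e1 (\<mu> * t)))
    = integral {-L/2..L/2} (\<lambda>t. \<Sum>k\<le>N. b k * (of_real (cos (pi * t / L)) * e1 ((lam k + \<mu>) * t)))"
    unfolding e sum_distrib_left sum_distrib_right by (simp only: mult_ac)
  also have "\<dots> = (\<Sum>k\<le>N. integral {-L/2..L/2} (\<lambda>t. b k * (of_real (cos (pi * t / L)) * e1 ((lam k + \<mu>) * t))))"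
    using assms by (intro integral_sum integrable_continuous_interval continuous_intros) auto
  finally show ?thesis by (simp add: window_ft_def)
qed

text \<open>
  The upper half of Ingham's inequality: on an interval of length at most two the weight
  \<open>cos (\<pi> t / 4)\<close> of the window of length four is bounded below by \<open>\<surd>2 / 2\<close>, and the row sums of its
  Gram matrix bound the quadratic form by Schur's test.
\<close>
lemma exponential_sum_l2_bound:
  fixes N :: nat and b :: "nat \<Rightarrow> complex" and lam :: "nat \<Rightarrow> real"
  assumes L: "0 < L" "L \<le> 2"
    and sep: "\<And>k l. k \<le> N \<Longrightarrow> l \<le> N \<Longrightarrow> \<bar>real k - real l\<bar> \<le> \<bar>lam k - lam l\<bar>"
  shows "integral {-L/2..L/2} (\<lambda>t. (norm (\<Sum>k\<le>N. b k * e1 (lam k * t)))\<^sup>2) \<le> 5 * (\<Sum>k\<le>N. (norm (b k))\<^sup>2)"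
proof -
  define f where "f t = (\<Sum>k\<le>N. b k * e1 (lam k * t))" for t
  define \<kappa> where "\<kappa> k l = (if k = l then 8 / pi else 1 / (2 * pi) * (1 / (4 * (real k - real l)\<^sup>2 - 1)))" for k l :: nat
  have cf: "continuous_on S f" for S unfolding f_def by (intro continuous_intros)
  have \<kappa>: "norm (window_ft 4 (lam k - lam l)) \<le> \<kappa> k l" if "k \<le> N" "l \<le> N" for k l
  proof (cases "k = l")
    case False
    hence "\<bar>real k - real l\<bar> \<ge> 1" by linarith
    from norm_window_ft_le[OF _ this sep[OF that], of 4] False show ?thesis by (simp add: \<kappa>_def)
  qed (simp add: \<kappa>_def window_ft_0 norm_divide)
  have sym: "\<kappa> k l = \<kappa> l k" for k l by (simp add: \<kappa>_def power2_commute)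
  have pos: "\<kappa> k l \<ge> 0" if "k \<le> N" "l \<le> N" for k l using \<kappa>[OF that] norm_ge_zero order_trans by blast
  have row: "(\<Sum>l\<le>N. \<kappa> k l) \<le> 3" if "k \<le> N" for k
  proof -
    have "(\<Sum>l\<le>N. \<kappa> k l) = \<kappa> k k + (\<Sum>l\<in>{..N}-{k}. \<kappa> k l)"
      using that by (simp add: sum.remove)
    also have "(\<Sum>l\<in>{..N}-{k}. \<kappa> k l) = 1 / (2 * pi) * (\<Sum>l\<in>{..N}-{k}. 1 / (4 * (real k - real l)\<^sup>2 - 1))"
      unfolding sum_distrib_left by (intro sum.cong) (auto simp: \<kappa>_def)
    also have "\<dots> \<le> 1 / (2 * pi) * 1"
      using row_sum_le[OF that] by (intro mult_left_mono) auto
    also have "\<kappa> k k + 1 / (2 * pi) * 1 \<le> 3"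
      using pi_gt3 by (simp add: \<kappa>_def field_simps)
    finally show ?thesis by simp
  qed
  have "integral {-L/2..L/2} (\<lambda>t. (norm (f t))\<^sup>2) \<le> integral {-L/2..L/2} (\<lambda>t. 5/3 * (cos (pi * t / 4) * (norm (f t))\<^sup>2))"
  proof (intro integral_le integrable_continuous_interval continuous_intros cf)
    fix t assume "t \<in> {-L/2..L/2}"
    hence t: "\<bar>t\<bar> \<le> 1" using L by auto
    have "cos (pi/4) \<le> cos (\<bar>pi * t / 4\<bar>)"
      using t by (intro cos_monotone_0_pi_le) (auto simp: abs_mult)
    hence "sqrt 2 / 2 \<le> cos (pi * t / 4)" by (simp only: cos_45 cos_abs_real)
    moreover have "sqrt 2 \<ge> 1.2" by (rule real_le_rsqrt) (simp add: power2_eq_square)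
    ultimately have "1 \<le> 5/3 * cos (pi * t / 4)" by simp
    from mult_right_mono[OF this, of "(norm (f t))\<^sup>2"]
    show "(norm (f t))\<^sup>2 \<le> 5/3 * (cos (pi * t / 4) * (norm (f t))\<^sup>2)" by simp
  qed auto
  also have "\<dots> \<le> integral {-4/2..4/2} (\<lambda>t. 5/3 * (cos (pi * t / 4) * (norm (f t))\<^sup>2))"
  proof (intro integral_subset_le ballI integrable_continuous_interval continuous_intros cf)
    fix t :: real assume "t \<in> {-4/2..4/2}"
    hence t: "-2 \<le> t" "t \<le> 2" by auto
    have "pi * (-2) \<le> pi * t" "pi * t \<le> pi * 2" by (rule mult_left_mono; use t in simp)+
    hence "0 \<le> cos (pi * t / 4)" by (intro cos_ge_zero) auto
    thus "0 \<le> 5/3 * (cos (pi * t / 4) * (norm (f t))\<^sup>2)" by simp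
  qed (use L in auto)
  also have "\<dots> = 5/3 * integral {-4/2..4/2} (\<lambda>t. cos (pi * t / 4) * (norm (f t))\<^sup>2)" by simp
  also have "\<dots> \<le> 5/3 * (3 * (\<Sum>k\<le>N. (norm (b k))\<^sup>2))"
  proof (intro mult_left_mono)
    have cnjf: "cnj (f t) = (\<Sum>l\<le>N. cnj (b l) * e1 ((- lam l) * t))" for t
      by (simp add: f_def cis_cnj)
    have "of_real (integral {-4/2..4/2} (\<lambda>t. cos (pi * t / 4) * (norm (f t))\<^sup>2))
      = integral {-4/2..4/2} (\<lambda>t. of_real (cos (pi * t / 4) * (norm (f t))\<^sup>2) :: complex)"
      by (intro integral_of_real_on[symmetric] integrable_continuous_interval continuous_intros cf) auto
    also have "\<dots> = integral {-4/2..4/2} (\<lambda>t. \<Sum>l\<le>N. cnj (b l) * (of_real (cos (pi * t / 4)) * (f t * e1 ((- lam l) * t))))"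
      by (simp only: of_real_mult complex_norm_square cnjf sum_distrib_left mult_ac)
    also have "\<dots> = (\<Sum>l\<le>N. integral {-4/2..4/2} (\<lambda>t. cnj (b l) * (of_real (cos (pi * t / 4)) * (f t * e1 ((- lam l) * t)))))"
      by (intro integral_sum integrable_continuous_interval continuous_intros cf) auto
    also have "\<dots> = (\<Sum>l\<le>N. cnj (b l) * (\<Sum>k\<le>N. b k * window_ft 4 (lam k + - lam l)))"
      unfolding integral_mult_right f_def by (subst gram_expansion) simp_all
    finally have eq: "of_real (integral {-4/2..4/2} (\<lambda>t. cos (pi * t / 4) * (norm (f t))\<^sup>2))
       = (\<Sum>l\<le>N. cnj (b l) * (\<Sum>k\<le>N. b k * window_ft 4 (lam k + - lam l)))" .
    have "integral {-4/2..4/2} (\<lambda>t. cos (pi * t / 4) * (norm (f t))\<^sup>2)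
       \<le> norm (of_real (integral {-4/2..4/2} (\<lambda>t. cos (pi * t / 4) * (norm (f t))\<^sup>2)) :: complex)" by simp
    also have "\<dots> = norm (\<Sum>l\<le>N. cnj (b l) * (\<Sum>k\<le>N. b k * window_ft 4 (lam k + - lam l)))"
      unfolding eq ..
    also have "\<dots> \<le> (\<Sum>l\<le>N. \<Sum>k\<le>N. \<kappa> k l * (norm (b l) * norm (b k)))"
      unfolding sum_distrib_left
      by (intro sum_norm_le) (auto simp: norm_mult mult_ac intro!: mult_left_mono \<kappa>)
    also have "\<dots> \<le> (\<Sum>l\<le>N. \<Sum>k\<le>N. \<kappa> k l * (((norm (b l))\<^sup>2 + (norm (b k))\<^sup>2) / 2))"
      using sum_squares_bound[of "norm (b _)" "norm (b _)"]
      by (intro sum_mono mult_left_mono pos) (auto simp: algebra_simps)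
    also have "\<dots> = (\<Sum>l\<le>N. \<Sum>k\<le>N. \<kappa> l k * (norm (b l))\<^sup>2) / 2 + (\<Sum>l\<le>N. \<Sum>k\<le>N. \<kappa> k l * (norm (b k))\<^sup>2) / 2"
      by (simp add: distrib_left add_divide_distrib sum.distrib sum_divide_distrib sym)
    also have "(\<Sum>l\<le>N. \<Sum>k\<le>N. \<kappa> k l * (norm (b k))\<^sup>2) = (\<Sum>l\<le>N. \<Sum>k\<le>N. \<kappa> l k * (norm (b l))\<^sup>2)"
      by (rule sum.swap)
    also have "(\<Sum>l\<le>N. \<Sum>k\<le>N. \<kappa> l k * (norm (b l))\<^sup>2) / 2 + (\<Sum>l\<le>N. \<Sum>k\<le>N. \<kappa> l k * (norm (b l))\<^sup>2) / 2
       = (\<Sum>l\<le>N. (\<Sum>k\<le>N. \<kappa> l k) * (norm (b l))\<^sup>2)"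
      by (simp add: sum_distrib_right)
    also have "\<dots> \<le> (\<Sum>l\<le>N. 3 * (norm (b l))\<^sup>2)"
      by (intro sum_mono mult_right_mono row) auto
    finally show "integral {-4/2..4/2} (\<lambda>t. cos (pi * t / 4) * (norm (f t))\<^sup>2) \<le> 3 * (\<Sum>k\<le>N. (norm (b k))\<^sup>2)"
      by (simp add: sum_distrib_left)
  qed auto
  finally show ?thesis by (simp add: f_def)
qed


section \<open>One-sided trigonometric polynomials\<close>

text \<open>
  As \<open>t\<close> runs through the window, \<open>circ L t\<close> runs through the lower half of the unit circle once,
  so that \<open>Re (circ L t) = cos (\<pi> (t / L + 1/2))\<close> parametrises \<open>[-1, 1]\<close> bijectively and any
  continuous function on the window is a continuous function of this real part. Polynomials in
  \<open>circ L\<close> are the trigonometric polynomials of period \<open>2 L\<close> with nonpositive frequencies only.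
\<close>
definition circ :: "real \<Rightarrow> real \<Rightarrow> complex" where
  "circ L t = cis (-(pi * (t / L + 1/2)))"

lemma norm_circ [simp]: "norm (circ L t) = 1"
  by (simp add: circ_def)

text \<open>
  The second half \<open>[L/2, 3L/2]\<close> of the period is the mirror image of the window. For polynomials
  with real coefficients this lets norms over the window be computed over a full period, where
  the powers of \<open>circ L\<close> are orthogonal.
\<close>
lemma circ_reflect: "L > 0 \<Longrightarrow> circ L (L - t) = cnj (circ L t)"
proof -
  assume L: "L > 0"
  have "circ L (L - t) = cis (pi * (t / L + 1/2) - 2 * pi)"
    using L unfolding circ_def by (intro arg_cong[where f = cis]) (simp add: field_simps)
  also have "\<dots> = cis (pi * (t / L + 1/2))"
    by (simp flip: cis_divide)
  finally show ?thesis by (simp add: circ_def cis_cnj)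
qed

lemma continuous_on_circ [continuous_intros]: "L > 0 \<Longrightarrow> continuous_on S (circ L)"
  unfolding circ_def by (intro continuous_intros) auto

lemma continuous_on_poly_circ [continuous_intros]:
  "L > 0 \<Longrightarrow> continuous_on S (\<lambda>t. poly q (circ L t))" for q :: "complex poly"
  using continuous_on_poly[OF continuous_on_circ] by simp

lemma integral_character:
  fixes n :: int
  assumes L: "L > 0"
  shows "integral {-L/2..3*L/2} (\<lambda>t. cis (of_int n * (pi * (t / L + 1/2)))) = (if n = 0 then of_real (2 * L) else 0)"
proof (cases "n = 0")
  case True
  then show ?thesis using L by (simp add: scaleR_conv_of_real)
next
  case False
  define c where "c = of_int n * pi / L"
  define d where "d = of_int n * pi / 2"
  have c0: "c \<noteq> 0" using False L by (simp add: c_def)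
  have cd: "of_int n * (pi * (t / L + 1/2)) = c * t + d" for t
    by (simp add: c_def d_def distrib_left)
  define G where "G t = cis (c * t + d) / (\<i> * of_real c)" for t
  have "((\<lambda>t. cis (c * t + d)) has_integral (G (3*L/2) - G (-L/2))) {-L/2..3*L/2}"
  proof (rule fundamental_theorem_of_calculus)
    fix t
    have "(G has_vector_derivative (c *\<^sub>R (\<i> * cis (c * t + d))) / (\<i> * of_real c)) (at t within {-L/2..3*L/2})"
      unfolding G_def has_vector_derivative_def
      by (rule derivative_eq_intros refl | simp add: fun_eq_iff c0 scaleR_conv_of_real | simp add: complex_eq_iff)+
    thus "(G has_vector_derivative cis (c * t + d)) (at t within {-L/2..3*L/2})"
      using c0 by (simp add: scaleR_conv_of_real)
  qed (use L in auto)
  moreover have "G (3*L/2) = G (-L/2)"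
  proof -
    have ends: "c * (3*L/2) + d = 2 * pi * of_int n" "c * (-L/2) + d = 0"
      using L by (simp_all add: c_def d_def)
    show ?thesis by (simp only: G_def ends cis_multiple_2pi Ints_of_int cis_zero)
  qed
  ultimately show ?thesis using False by (simp add: integral_unique cd)
qed

lemma integral_poly_circ_character:
  fixes q :: "complex poly"
  assumes L: "L > 0"
  shows "integral {-L/2..3*L/2} (\<lambda>t. poly q (circ L t) * cis (real m * (pi * (t / L + 1/2)))) = coeff q m * of_real (2 * L)"
proof -
  have pt: "poly q (circ L t) * cis (real m * (pi * (t / L + 1/2)))
     = (\<Sum>i\<le>degree q. coeff q i * cis (of_int (int m - int i) * (pi * (t / L + 1/2))))" for t
  proof -
    have "circ L t ^ i * cis (real m * (pi * (t / L + 1/2))) = cis (of_int (int m - int i) * (pi * (t / L + 1/2)))" for i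
      by (simp add: circ_def Complex.DeMoivre cis_mult left_diff_distrib)
    thus ?thesis by (simp only: poly_altdef sum_distrib_right mult.assoc)
  qed
  have "integral {-L/2..3*L/2} (\<lambda>t. poly q (circ L t) * cis (real m * (pi * (t / L + 1/2))))
     = (\<Sum>i\<le>degree q. integral {-L/2..3*L/2} (\<lambda>t. coeff q i * cis (of_int (int m - int i) * (pi * (t / L + 1/2)))))"
    unfolding pt using L
    by (intro integral_sum integrable_continuous_interval continuous_intros) auto
  also have "\<dots> = (\<Sum>i\<le>degree q. if i = m then coeff q m * of_real (2 * L) else 0)"
    unfolding integral_mult_right integral_character[OF L] by (intro sum.cong) auto
  also have "\<dots> = coeff q m * of_real (2 * L)"
    by (simp add: coeff_eq_0)
  finally show ?thesis .
qed

lemma norm_coeff_le_mean: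
  fixes q :: "complex poly"
  assumes L: "L > 0"
  shows "norm (coeff q m) \<le> (1 / (2 * L)) * integral {-L/2..3*L/2} (\<lambda>t. norm (poly q (circ L t)))"
proof -
  have "norm (coeff q m) * (2 * L) = norm (integral {-L/2..3*L/2} (\<lambda>t. poly q (circ L t) * cis (real m * (pi * (t / L + 1/2)))))"
    unfolding integral_poly_circ_character[OF L] using L by (simp add: norm_mult)
  also have "\<dots> \<le> integral {-L/2..3*L/2} (\<lambda>t. norm (poly q (circ L t)))"
    using L by (intro integral_norm_bound_integral integrable_continuous_interval continuous_intros)
      (auto simp: norm_mult)
  finally show ?thesis using L by (simp add: field_simps)
qed

lemma integral_reflection_symmetric:
  fixes g :: "real \<Rightarrow> real"
  assumes L: "L > 0" and g: "continuous_on UNIV g" and sym: "\<And>t. g (L - t) = g t"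
  shows "integral {-L/2..3*L/2} g = 2 * integral {-L/2..L/2} g"
proof -
  have "(g has_integral integral {-L/2..L/2} g) (cbox (-L/2) (L/2))"
    using continuous_on_subset[OF g] by (auto intro!: integrable_integral integrable_continuous_interval)
  from has_integral_affinity[OF this, of "-1" L]
  have "((\<lambda>t. g (L - t)) has_integral integral {-L/2..L/2} g) ((\<lambda>x. L - x) ` {-L/2..L/2})"
    by simp
  also have "(\<lambda>x. L - x) ` {-L/2..L/2} = {L/2..3*L/2}"
    by (auto simp: image_iff field_simps intro!: bexI[of _ "L - _"])
  finally have "integral {L/2..3*L/2} g = integral {-L/2..L/2} g"
    by (simp add: sym integral_unique)
  moreover have "integral {-L/2..L/2} g + integral {L/2..3*L/2} g = integral {-L/2..3*L/2} g"
    using L by (intro Henstock_Kurzweil_Integration.integral_combine integrable_continuous_interval continuous_on_subset[OF g]) auto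
  ultimately show ?thesis by simp
qed

text \<open>
  The mean of \<open>h\<^sup>2\<close> over a period is the square of the constant coefficient, which is real, so
  it is nonnegative: the imaginary part of \<open>h\<close> has no larger mean square than the real part.
  This plays the role of the bound for the conjugate function in mean square.
\<close>
lemma one_sided_l2_le_real_part:
  fixes q :: "complex poly"
  assumes L: "L > 0" and real: "\<And>z. poly q (cnj z) = cnj (poly q z)"
  shows "integral {-L/2..L/2} (\<lambda>t. (norm (poly q (circ L t)))\<^sup>2)
     \<le> 2 * integral {-L/2..L/2} (\<lambda>t. (Re (poly q (circ L t)))\<^sup>2)"
proof -
  define h where "h t = poly q (circ L t)" for t
  have ch: "continuous_on S h" for S unfolding h_def using L by (intro continuous_intros)
  have sym: "h (L - t) = cnj (h t)" for t using L by (simp add: h_def circ_reflect real)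
  have "integral {-L/2..3*L/2} (\<lambda>t. (h t)\<^sup>2) = coeff (q\<^sup>2) 0 * of_real (2 * L)"
    using integral_poly_circ_character[OF L, of "q\<^sup>2" 0] by (simp add: h_def)
  moreover have "coeff (q\<^sup>2) 0 = (poly q 0)\<^sup>2" by (simp add: poly_0_coeff_0[symmetric])
  moreover have "Im (poly q 0) = 0" using real[of 0] by (simp add: complex_eq_iff)
  ultimately have "0 \<le> Re (integral {-L/2..3*L/2} (\<lambda>t. (h t)\<^sup>2))"
    using L by (simp add: power2_eq_square)
  also have "\<dots> = integral {-L/2..3*L/2} (\<lambda>t. Re ((h t)\<^sup>2))"
    by (intro integral_unique[symmetric] has_integral_Re integrable_integral
        integrable_continuous_interval continuous_intros ch)
  also have "\<dots> = integral {-L/2..3*L/2} (\<lambda>t. 2 * (Re (h t))\<^sup>2 - (norm (h t))\<^sup>2)"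
    by (simp add: power2_eq_square cmod_def flip: real_sqrt_mult)
  also have "\<dots> = 2 * integral {-L/2..L/2} (\<lambda>t. 2 * (Re (h t))\<^sup>2 - (norm (h t))\<^sup>2)"
    using L by (intro integral_reflection_symmetric continuous_intros ch) (auto simp: sym)
  also have "integral {-L/2..L/2} (\<lambda>t. 2 * (Re (h t))\<^sup>2 - (norm (h t))\<^sup>2)
     = integral {-L/2..L/2} (\<lambda>t. 2 * (Re (h t))\<^sup>2) - integral {-L/2..L/2} (\<lambda>t. (norm (h t))\<^sup>2)"
    by (intro integral_diff integrable_continuous_interval continuous_intros ch)
  finally show ?thesis by (simp add: h_def)
qed

text \<open>
  On the unit circle, if \<open>q(z) = a + z p(z)\<close> with \<open>a\<close> real, then
  \<open>2 Re z \<sqdot> q(z) = z q(z) + z\<^sup>* q(z) = z q(z) + a z\<^sup>* + p(z)\<close>, writing \<open>z\<^sup>*\<close> for the conjugate, and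
  \<open>a z\<^sup>*\<close> may be replaced by \<open>a z\<close> without changing the real part. So multiplication by \<open>Re z\<close>
  preserves the real parts of polynomials with real coefficients.
\<close>
lemma Re_power_eq_Re_poly:
  "\<exists>q :: complex poly. (\<forall>i. coeff q i \<in> \<real>) \<and> (\<forall>z. norm z = 1 \<longrightarrow> Re (poly q z) = (Re z) ^ n)"
proof (induction n)
  case 0
  show ?case by (rule exI[of _ 1]) (simp add: coeff_1)
next
  case (Suc n)
  then obtain q :: "complex poly" where q: "\<And>i. coeff q i \<in> \<real>"
      "\<And>z. norm z = 1 \<Longrightarrow> Re (poly q z) = (Re z) ^ n" by blast
  obtain a p where qp: "q = pCons a p" by (cases q)
  have a: "a \<in> \<real>" using q(1)[of 0] by (simp add: qp)
  have p: "coeff p i \<in> \<real>" for i using q(1)[of "Suc i"] by (simp add: qp)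
  define r where "r = smult (1/2) (pCons 0 (q + [:a:]) + p)"
  show ?case
  proof (intro exI[of _ r] conjI allI impI)
    fix i show "coeff r i \<in> \<real>"
      using a p q(1) by (auto simp: r_def coeff_pCons split: nat.splits)
  next
    fix z :: complex assume z: "norm z = 1"
    have zz: "z * cnj z = 1" using z by (simp add: complex_norm_square[symmetric])
    have "of_real (Re z) = (z + cnj z) / 2" by (simp add: complex_eq_iff)
    hence "of_real (Re z) * poly q z = (1/2) * (z * poly q z + cnj z * poly q z)"
      by (simp only:) (simp add: distrib_right add_divide_distrib)
    also have "cnj z * poly q z = a * cnj z + (z * cnj z) * poly p z"
      by (simp add: qp algebra_simps)
    finally have eq: "of_real (Re z) * poly q z = (1/2) * (z * poly q z + (a * cnj z + poly p z))"
      unfolding zz by simp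
    have "Re z * Re (poly q z) = Re (of_real (Re z) * poly q z)" by simp
    also have "\<dots> = Re (poly r z)"
      unfolding eq using a by (simp add: r_def complex_is_Real_iff algebra_simps)
    finally show "Re (poly r z) = (Re z) ^ Suc n" using q(2)[OF z] by simp
  qed
qed

text \<open>
  Weierstrass approximation in the variable \<open>Re (circ L t)\<close>, with the approximant
  shifted up by the size \<open>\<eta>\<close> of the error; a polynomial in a real part on the circle is the real
  part of a polynomial.
\<close>
lemma one_sided_majorant:
  fixes g :: "real \<Rightarrow> real"
  assumes L: "L > 0" and \<eta>: "\<eta> > 0" and g: "continuous_on {-L/2..L/2} g"
  obtains q :: "complex poly" where "\<And>z. poly q (cnj z) = cnj (poly q z)"
    "\<And>t. t \<in> {-L/2..L/2} \<Longrightarrow> g t \<le> Re (poly q (circ L t))"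
    "\<And>t. t \<in> {-L/2..L/2} \<Longrightarrow> Re (poly q (circ L t)) \<le> g t + 2 * \<eta>"
proof -
  define \<tau> where "\<tau> x = L * (arccos x / pi - 1/2)" for x
  have \<tau>: "\<tau> x \<in> {-L/2..L/2}" if "x \<in> {-1..1}" for x
  proof -
    have "0 \<le> arccos x / pi" "arccos x / pi \<le> 1" using that arccos_lbound arccos_ubound by auto
    hence "L * (0 - 1/2) \<le> \<tau> x" "\<tau> x \<le> L * (1 - 1/2)" unfolding \<tau>_def using L
      by (intro mult_left_mono diff_right_mono; simp)+
    thus ?thesis by simp
  qed
  have "continuous_on {-1..1} (\<lambda>x. g (\<tau> x))"
    by (rule continuous_on_compose2[OF g]) (use \<tau> in \<open>auto simp: \<tau>_def intro!: continuous_intros\<close>)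
  then obtain p where p: "real_polynomial_function p" "\<And>x. x \<in> {-1..1} \<Longrightarrow> \<bar>g (\<tau> x) - p x\<bar> < \<eta>"
    using Stone_Weierstrass_real_polynomial_function[of "{-1..1::real}" _ \<eta>] \<eta> by (metis compact_Icc)
  obtain a n where an: "p = (\<lambda>x. \<Sum>i\<le>n. a i * x ^ i)"
    using p(1) real_polynomial_function_iff_sum by blast
  obtain c :: "nat \<Rightarrow> complex poly" where c0: "\<And>i j. coeff (c i) j \<in> \<real>"
     and c: "\<And>i z. norm z = 1 \<Longrightarrow> Re (poly (c i) z) = (Re z) ^ i"
    using Re_power_eq_Re_poly by metis
  have c1: "poly (c i) (cnj z) = cnj (poly (c i) z)" for i z
    using poly_cnj_real[OF c0] by simp
  define q where "q = (\<Sum>i\<le>n. smult (of_real (a i)) (c i)) + [:of_real \<eta>:]"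
  have Req: "Re (poly q (circ L t)) = p (Re (circ L t)) + \<eta>" for t
    by (simp add: q_def poly_sum an c)
  have tt: "\<tau> (Re (circ L t)) = t" "Re (circ L t) \<in> {-1..1}" if t: "t \<in> {-L/2..L/2}" for t
  proof -
    have "-1/2 \<le> t / L" "t / L \<le> 1/2" using t L by (auto simp: field_simps)
    hence "0 \<le> t / L + 1/2" "t / L + 1/2 \<le> 1" by linarith+
    hence "0 \<le> pi * (t / L + 1/2)" "pi * (t / L + 1/2) \<le> pi * 1"
      by (simp, intro mult_left_mono, auto)
    hence "arccos (Re (circ L t)) = pi * (t / L + 1/2)"
      by (simp add: circ_def arccos_cos)
    thus "\<tau> (Re (circ L t)) = t" using L by (simp add: \<tau>_def)
    show "Re (circ L t) \<in> {-1..1}" by (simp add: circ_def)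
  qed
  show ?thesis
  proof (rule that[of q])
    show "poly q (cnj z) = cnj (poly q z)" for z by (simp add: q_def poly_sum c1)
    show "g t \<le> Re (poly q (circ L t))" "Re (poly q (circ L t)) \<le> g t + 2 * \<eta>" if "t \<in> {-L/2..L/2}" for t
      using p(2)[OF tt(2)[OF that]] tt(1)[OF that] unfolding Req by auto
  qed
qed

text \<open>
  All frequencies of \<open>e1 (- X t) q (circ L t)\<close> lie at or below \<open>- X\<close>, in an arithmetic
  progression of step \<open>1 / (2 L)\<close>. The transform of the window is summable along it with sum at most
  \<open>1 / X\<close>, and every coefficient of \<open>q\<close> is at most the mean of its modulus.
\<close>
lemma one_sided_pairing_poly:
  fixes q :: "complex poly"
  assumes L: "L \<ge> 1" and X: "X \<ge> 1"
  shows "norm (integral {-L/2..L/2} (\<lambda>t. of_real (cos (pi * t / L)) * e1 (- X * t) * poly q (circ L t)))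
     \<le> (1 / X) * ((1 / (2 * L)) * integral {-L/2..3*L/2} (\<lambda>t. norm (poly q (circ L t))))"
proof -
  define C where "C = (1 / (2 * L)) * integral {-L/2..3*L/2} (\<lambda>t. norm (poly q (circ L t)))"
  have C: "norm (coeff q m) \<le> C" for m unfolding C_def using L by (intro norm_coeff_le_mean) auto
  have C0: "C \<ge> 0" using C[of 0] norm_ge_zero order_trans by blast
  have pt: "of_real (cos (pi * t / L)) * e1 (- X * t) * poly q (circ L t)
     = (\<Sum>i\<le>degree q. (coeff q i * cis (- (real i * pi / 2))) * (of_real (cos (pi * t / L)) * e1 (- (X + real i / (2 * L)) * t)))" for t
  proof -
    have "e1 (- X * t) * circ L t ^ i = cis (- (real i * pi / 2)) * e1 (- (X + real i / (2 * L)) * t)" for i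
      unfolding circ_def Complex.DeMoivre cis_mult using L
      by (intro arg_cong[where f = cis]) (simp add: field_simps)
    hence "coeff q i * (of_real (cos (pi * t / L)) * (e1 (- X * t) * circ L t ^ i))
       = coeff q i * (of_real (cos (pi * t / L)) * (cis (- (real i * pi / 2)) * e1 (- (X + real i / (2 * L)) * t)))" for i
      by simp
    thus ?thesis by (simp only: poly_altdef sum_distrib_left mult_ac)
  qed
  have "integral {-L/2..L/2} (\<lambda>t. of_real (cos (pi * t / L)) * e1 (- X * t) * poly q (circ L t))
     = (\<Sum>i\<le>degree q. integral {-L/2..L/2} (\<lambda>t. (coeff q i * cis (- (real i * pi / 2))) * (of_real (cos (pi * t / L)) * e1 (- (X + real i / (2 * L)) * t))))"
    unfolding pt using L
    by (intro integral_sum integrable_continuous_interval continuous_intros) auto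
  also have "\<dots> = (\<Sum>i\<le>degree q. (coeff q i * cis (- (real i * pi / 2))) * window_ft L (- (X + real i / (2 * L))))"
    by (simp only: integral_mult_right window_ft_def)
  also have "norm \<dots> \<le> (\<Sum>i\<le>degree q. C * norm (window_ft L (- (X + real i / (2 * L)))))"
    by (intro sum_norm_le) (auto simp: norm_mult intro!: mult_right_mono C)
  also have "\<dots> = C * (\<Sum>i\<le>degree q. norm (window_ft L (- (X + real i / (2 * L)))))"
    by (simp add: sum_distrib_left)
  also have "\<dots> \<le> C * (1 / X)"
  proof (intro mult_left_mono C0)
    have "(\<Sum>i\<le>degree q. norm (window_ft L (- (X + real i / (2 * L)))))
      \<le> (\<Sum>i\<le>degree q. (8 * L / (3 * pi)) * (1 / (2 * L * X + real i)\<^sup>2))"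
    proof (intro sum_mono)
      fix i
      define x where "x = X + real i / (2 * L)"
      have x1: "x \<ge> 1" using X L by (simp add: x_def add_increasing2)
      have x2: "x\<^sup>2 \<ge> 1" using x1 by simp
      have "norm (window_ft L (- x)) \<le> 2 / (pi * L) * (1 / (4 * x\<^sup>2 - 1))"
        using L x1 by (intro norm_window_ft_le) auto
      also have "\<dots> \<le> 2 / (pi * L) * (1 / (3 * x\<^sup>2))"
      proof -
        have "0 < 4 * x\<^sup>2 - 1" "3 * x\<^sup>2 \<le> 4 * x\<^sup>2 - 1" "0 < x\<^sup>2" using x2 by linarith+
        thus ?thesis using L by (intro mult_left_mono divide_left_mono mult_pos_pos) auto
      qed
      also have "\<dots> = (8 * L / (3 * pi)) * (1 / (2 * L * x)\<^sup>2)"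
        using L by (simp add: power2_eq_square)
      also have "2 * L * x = 2 * L * X + real i" using L by (simp add: x_def distrib_left)
      finally show "norm (window_ft L (- (X + real i / (2 * L)))) \<le> (8 * L / (3 * pi)) * (1 / (2 * L * X + real i)\<^sup>2)"
        unfolding x_def .
    qed
    also have "\<dots> = (8 * L / (3 * pi)) * (\<Sum>i<Suc (degree q). 1 / (2 * L * X + real i)\<^sup>2)"
      by (simp add: sum_distrib_left lessThan_Suc_atMost)
    also have "\<dots> \<le> (8 * L / (3 * pi)) * (2 / (2 * L * X))"
    proof (intro mult_left_mono sum_inverse_squares_le)
      have "1 * 1 \<le> L * X" using L X by (intro mult_mono) auto
      thus "1 \<le> 2 * L * X" by simp
    qed (use L in auto)
    also have "\<dots> \<le> 1 / X"
      using L X pi_gt3 by (simp add: field_simps)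
    finally show "(\<Sum>i\<le>degree q. norm (window_ft L (- (X + real i / (2 * L))))) \<le> 1 / X" .
  qed
  finally show ?thesis by (simp add: C_def mult.commute)
qed

text \<open>
  Passage to uniform limits, needed because the exponential of a one-sided polynomial is only a
  limit of such polynomials.
\<close>
lemma one_sided_pairing:
  fixes G :: "real \<Rightarrow> complex"
  assumes L: "L \<ge> 1" and X: "X \<ge> 1" and G: "continuous_on UNIV G"
    and approx: "\<And>\<eta>. \<eta> > 0 \<Longrightarrow> \<exists>q :: complex poly. \<forall>t. norm (G t - poly q (circ L t)) \<le> \<eta>"
  shows "norm (integral {-L/2..L/2} (\<lambda>t. of_real (cos (pi * t / L)) * e1 (- X * t) * G t))
     \<le> (1 / X) * ((1 / (2 * L)) * integral {-L/2..3*L/2} (\<lambda>t. norm (G t)))"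
proof (rule field_le_epsilon)
  fix e :: real assume e: "e > 0"
  \<comment> \<open>An approximation error \<open>\<eta>\<close> changes the left side by at most \<open>L \<eta>\<close> and the right side by \<open>\<eta> / X\<close>.\<close>
  define \<eta> where "\<eta> = e / (1 / X + L)"
  have "1 / X + L > 0" using L X by (simp add: add_pos_pos)
  hence \<eta>: "\<eta> > 0" "\<eta> * (1 / X + L) = e" using e by (auto simp: \<eta>_def)
  obtain q :: "complex poly" where q: "\<And>t. norm (G t - poly q (circ L t)) \<le> \<eta>"
    using approx[OF \<eta>(1)] by blast
  define w where "w t = of_real (cos (pi * t / L)) * e1 (- X * t)" for t
  have cG: "continuous_on S G" for S using G continuous_on_subset by blast
  have L0: "L > 0" using L by simp
  have cw: "continuous_on S w" for S unfolding w_def using L0 by (intro continuous_intros) auto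
  note cont = integrable_continuous_interval continuous_intros cG cw L0
  have nw: "norm (w t) \<le> 1" for t by (simp add: w_def norm_mult)
  have "integral {-L/2..L/2} (\<lambda>t. w t * G t)
     = integral {-L/2..L/2} (\<lambda>t. w t * poly q (circ L t)) + integral {-L/2..L/2} (\<lambda>t. w t * (G t - poly q (circ L t)))"
    by (subst integral_add[symmetric]) (auto intro!: cont simp: algebra_simps)
  hence "norm (integral {-L/2..L/2} (\<lambda>t. w t * G t))
     \<le> norm (integral {-L/2..L/2} (\<lambda>t. w t * poly q (circ L t))) + norm (integral {-L/2..L/2} (\<lambda>t. w t * (G t - poly q (circ L t))))"
    by (simp only: norm_triangle_ineq)
  moreover have "norm (integral {-L/2..L/2} (\<lambda>t. w t * (G t - poly q (circ L t)))) \<le> integral {-L/2..L/2} (\<lambda>t. \<eta>)"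
  proof (intro integral_norm_bound_integral)
    fix t
    show "norm (w t * (G t - poly q (circ L t))) \<le> \<eta>"
      using mult_mono[OF nw[of t] q[of t]] by (simp add: norm_mult)
  qed (auto intro!: cont)
  moreover have "integral {-L/2..L/2} (\<lambda>t. \<eta>) = L * \<eta>" using L0 by simp
  moreover have "norm (integral {-L/2..L/2} (\<lambda>t. w t * poly q (circ L t)))
     \<le> (1 / X) * ((1 / (2 * L)) * integral {-L/2..3*L/2} (\<lambda>t. norm (poly q (circ L t))))"
    unfolding w_def by (rule one_sided_pairing_poly[OF L X])
  moreover have "(1 / X) * ((1 / (2 * L)) * integral {-L/2..3*L/2} (\<lambda>t. norm (poly q (circ L t))))
     \<le> (1 / X) * ((1 / (2 * L)) * (integral {-L/2..3*L/2} (\<lambda>t. norm (G t)) + 2 * L * \<eta>))"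
  proof (intro mult_left_mono)
    have "integral {-L/2..3*L/2} (\<lambda>t. norm (poly q (circ L t)))
      \<le> integral {-L/2..3*L/2} (\<lambda>t. norm (G t) + \<eta>)"
    proof (intro integral_le cont)
      fix t
      have "norm (poly q (circ L t)) - norm (G t) \<le> norm (poly q (circ L t) - G t)"
        by (rule norm_triangle_ineq2)
      thus "norm (poly q (circ L t)) \<le> norm (G t) + \<eta>" using q[of t] by (simp add: norm_minus_commute)
    qed
    also have "\<dots> = integral {-L/2..3*L/2} (\<lambda>t. norm (G t)) + integral {-L/2..3*L/2} (\<lambda>t. \<eta>)"
      by (intro integral_add cont)
    also have "integral {-L/2..3*L/2} (\<lambda>t. \<eta>) = 2 * L * \<eta>" using L0 by simp
    finally show "integral {-L/2..3*L/2} (\<lambda>t. norm (poly q (circ L t)))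
      \<le> integral {-L/2..3*L/2} (\<lambda>t. norm (G t)) + 2 * L * \<eta>" .
  qed (use L0 X in auto)
  moreover have "(1 / X) * ((1 / (2 * L)) * (integral {-L/2..3*L/2} (\<lambda>t. norm (G t)) + 2 * L * \<eta>)) + L * \<eta>
     = (1 / X) * ((1 / (2 * L)) * integral {-L/2..3*L/2} (\<lambda>t. norm (G t))) + \<eta> * (1 / X + L)"
    using L X by (simp add: field_simps)
  ultimately show "norm (integral {-L/2..L/2} (\<lambda>t. of_real (cos (pi * t / L)) * e1 (- X * t) * G t))
     \<le> (1 / X) * ((1 / (2 * L)) * integral {-L/2..3*L/2} (\<lambda>t. norm (G t))) + e"
    unfolding \<eta>(2) w_def[symmetric] by linarith
qed

lemma exp_poly_approx:
  fixes S :: "complex poly"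
  assumes "\<eta> > 0"
  shows "\<exists>q. \<forall>z. norm z = 1 \<longrightarrow> norm (exp (poly S z) - poly q z) \<le> \<eta>"
proof -
  have "compact ((\<lambda>z. poly S z) ` sphere 0 1)"
    by (intro compact_continuous_image continuous_intros compact_sphere)
  from compact_imp_bounded[OF this] obtain R where R: "R > 0" "\<And>z. norm z = 1 \<Longrightarrow> norm (poly S z) \<le> R"
    unfolding bounded_pos by auto
  have "(\<lambda>n. exp R * R * (inverse (fact n) * R ^ n)) \<longlonglongrightarrow> exp R * R * 0"
    by (intro tendsto_mult tendsto_const summable_LIMSEQ_zero summable_exp)
  hence "\<forall>\<^sub>F n in sequentially. exp R * R * (inverse (fact n) * R ^ n) < \<eta>"
    using assms by (intro order_tendstoD) auto
  then obtain n where n: "exp R * R * (inverse (fact n) * R ^ n) < \<eta>"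
    by (auto simp: eventually_sequentially)
  define q where "q = (\<Sum>i\<le>n. smult (1 / fact i) (S ^ i))"
  show ?thesis
  proof (intro exI[of _ q] allI impI)
    fix z :: complex assume z: "norm z = 1"
    have "norm (exp (poly S z) - poly q z) = norm (exp (poly S z) - (\<Sum>i\<le>n. poly S z ^ i / fact i))"
      by (simp add: q_def poly_sum)
    also have "\<dots> \<le> exp (norm (poly S z)) * (norm (poly S z) ^ Suc n) / fact n"
      by (rule Taylor_exp_field)
    also have "\<dots> \<le> exp R * R ^ Suc n / fact n"
      using R(2)[OF z] by (intro divide_right_mono mult_mono power_mono) auto
    also have "\<dots> = exp R * R * (inverse (fact n) * R ^ n)" by (simp add: field_simps)
    finally show "norm (exp (poly S z) - poly q z) \<le> \<eta>" using n by simp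
  qed
qed

lemma norm_exp_minus_one_le:
  fixes z :: complex
  assumes "Re z \<ge> 0"
  shows "norm (exp (- z) - 1) \<le> norm z"
proof -
  have "norm (exp (- z) - exp 0) \<le> 1 * norm (- z - 0)"
  proof (rule field_differentiable_bound[where S = "{w. Re w \<le> 0}" and f' = exp])
    show "convex {w. Re w \<le> 0}" by (rule convex_halfspace_Re_le)
    show "(exp has_field_derivative exp w) (at w within {w. Re w \<le> 0})" for w :: complex
      by (rule DERIV_subset[OF DERIV_exp]) auto
  qed (use assms in auto)
  thus ?thesis by simp
qed

section \<open>Damping the blocks\<close>

text \<open>
  Passing from \<open>n\<close> to \<open>n + 1\<close> multiplies the sum by \<open>exp (- \<epsilon> h\<^sub>n\<^sub>+\<^sub>1)\<close> and adds
  \<open>f\<^sub>n\<^sub>+\<^sub>1\<close>. With \<open>x = |f\<^sub>n\<^sub>+\<^sub>1|\<close> and \<open>y = \<epsilon> x \<le> 1\<close> the bound \<open>M = 2 / \<epsilon>\<close> is kept because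
  \<open>M exp (- y) + x \<le> M (1 - y / 2) + x = M\<close>.
\<close>
lemma corrected_sum_bounded:
  fixes f h :: "nat \<Rightarrow> complex"
  assumes \<epsilon>: "0 < \<epsilon>" "3 * \<epsilon> \<le> 1"
    and f: "\<And>j. norm (f j) \<le> 3" and h: "\<And>j. norm (f j) \<le> Re (h j)"
  shows "norm (\<Sum>j\<le>n. f j * exp (- (of_real \<epsilon> * (\<Sum>i\<in>{j<..n}. h i)))) \<le> 2 / \<epsilon>"
proof (induction n)
  case 0
  have "norm (f 0) \<le> 3" by (rule f)
  also have "3 \<le> 2 / \<epsilon>" using \<epsilon> by (simp add: field_simps)
  finally show ?case by simp
next
  case (Suc n)
  define F where "F = (\<Sum>j\<le>n. f j * exp (- (of_real \<epsilon> * (\<Sum>i\<in>{j<..n}. h i))))"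
  have "{j<..Suc n} = insert (Suc n) {j<..n}" if "j \<le> n" for j using that by auto
  hence split: "(\<Sum>i\<in>{j<..Suc n}. h i) = h (Suc n) + (\<Sum>i\<in>{j<..n}. h i)" if "j \<le> n" for j
    using that by simp
  have "(\<Sum>j\<le>Suc n. f j * exp (- (of_real \<epsilon> * (\<Sum>i\<in>{j<..Suc n}. h i))))
      = F * exp (- (of_real \<epsilon> * h (Suc n))) + f (Suc n)"
  proof -
    have "exp (- (of_real \<epsilon> * (\<Sum>i\<in>{j<..Suc n}. h i)))
        = exp (- (of_real \<epsilon> * (\<Sum>i\<in>{j<..n}. h i))) * exp (- (of_real \<epsilon> * h (Suc n)))" if "j \<le> n" for j
      unfolding split[OF that] exp_add[symmetric] by (simp add: algebra_simps)
    thus ?thesis by (simp add: F_def sum_distrib_right mult.assoc)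
  qed
  also have "norm \<dots> \<le> norm F * exp (- (\<epsilon> * Re (h (Suc n)))) + norm (f (Suc n))"
    by (rule norm_triangle_le) (simp add: norm_mult)
  also have "\<dots> \<le> (2 / \<epsilon>) * exp (- (\<epsilon> * norm (f (Suc n)))) + norm (f (Suc n))"
    using Suc h[of "Suc n"] \<epsilon> by (intro add_mono mult_mono) (auto simp: F_def)
  also have "\<dots> \<le> 2 / \<epsilon>"
  proof -
    define y where "y = \<epsilon> * norm (f (Suc n))"
    have "y \<le> \<epsilon> * 3" unfolding y_def using \<epsilon> f by (intro mult_left_mono) auto
    hence y1: "y \<le> 1" using \<epsilon> by linarith
    have y0: "0 \<le> y" using \<epsilon> by (simp add: y_def)
    note y = y0 y1
    have "exp (- y) = 1 / exp y" by (simp add: exp_minus divide_inverse)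
    also have "\<dots> \<le> 1 / (1 + y)" using y exp_ge_add_one_self[of y] by (intro divide_left_mono mult_pos_pos) auto
    also have "\<dots> \<le> 1 - y / 2"
    proof -
      have "y * y \<le> y * 1" using y by (intro mult_left_mono) auto
      hence "1 \<le> (1 - y / 2) * (1 + y)" by (simp add: algebra_simps)
      thus ?thesis using y by (simp add: divide_le_eq)
    qed
    finally have "(2 / \<epsilon>) * exp (- y) \<le> (2 / \<epsilon>) * (1 - y / 2)"
      using \<epsilon> by (intro mult_left_mono) auto
    also have "\<dots> = 2 / \<epsilon> - norm (f (Suc n))" using \<epsilon> by (simp add: y_def field_simps)
    finally show ?thesis by (simp add: y_def)
  qed
  finally show ?case .
qed

text \<open>
  Blocks of ratio four rather than two keep the root mean squares of the block sums, which are of order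
  \<open>2\<^sup>-\<^sup>j / \<surd>Q\<close>, rational when \<open>Q\<close> is a square.
\<close>
lemma quaternary_blocks:
  fixes Q :: nat
  assumes "Q \<ge> 1"
  obtains blk :: "nat \<Rightarrow> nat" where "\<And>k. blk k \<le> k"
    "\<And>k. 4 ^ blk k * Q \<le> k + Q" "\<And>k. k + Q < 4 ^ (blk k + 1) * Q"
proof -
  define blk where "blk k = (LEAST j. k + Q < 4 ^ (j + 1) * Q)" for k
  have ex: "k + Q < 4 ^ (k + 1) * Q" for k
  proof -
    have "k + 1 < 4 ^ (k + 1)" by (induction k) auto
    hence "(k + 1) * Q < 4 ^ (k + 1) * Q" by (rule mult_strict_right_mono) (use assms in simp)
    moreover have "k + Q \<le> (k + 1) * Q" using assms by simp
    ultimately show ?thesis by linarith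
  qed
  show ?thesis
  proof (rule that[of blk])
    fix k
    show "blk k \<le> k" unfolding blk_def by (rule Least_le) (rule ex)
    show "k + Q < 4 ^ (blk k + 1) * Q" unfolding blk_def by (rule LeastI) (rule ex)
    show "4 ^ blk k * Q \<le> k + Q"
    proof (cases "blk k")
      case (Suc j)
      hence "j < (LEAST j. k + Q < 4 ^ (j + 1) * Q)" unfolding blk_def by simp
      from not_less_Least[OF this] show ?thesis by (simp add: Suc)
    qed simp
  qed
qed

lemma block_sums_le:
  fixes Q j :: nat
  assumes Q: "Q \<ge> 1" and D: "D \<subseteq> {k. 4 ^ j * Q \<le> k + Q \<and> k + Q < 4 ^ (j + 1) * Q}"
  shows "(\<Sum>k\<in>D. 1 / (real k + real Q)) \<le> 3"
    and "(\<Sum>k\<in>D. 1 / (real k + real Q)\<^sup>2) \<le> 3 / (4 ^ j * real Q)"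
proof -
  define m where "m = 4 ^ j * Q"
  have m: "m \<ge> Q" "m \<ge> 1" using Q by (auto simp: m_def)
  have sub: "D \<subseteq> {m - Q..<4 * m - Q}"
  proof
    fix k assume "k \<in> D"
    hence "m \<le> k + Q" "k + Q < 4 * m" using D by (auto simp: m_def)
    thus "k \<in> {m - Q..<4 * m - Q}" by auto
  qed
  have "card D \<le> card {m - Q..<4 * m - Q}" by (rule card_mono[OF _ sub]) simp
  also have "\<dots> = 3 * m" using m by simp
  finally have card: "real (card D) \<le> 3 * real m" by linarith
  have lower: "real m \<le> real k + real Q" if "k \<in> D" for k
  proof -
    have "m \<le> k + Q" using D that by (auto simp: m_def)
    thus ?thesis by (simp flip: of_nat_add)
  qed
  have m0: "real m > 0" using m by simp
  have den: "0 < real k + real Q" for k :: nat using Q by simp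
  have "(\<Sum>k\<in>D. 1 / (real k + real Q)) \<le> (\<Sum>k\<in>D. 1 / real m)"
    using lower m0 den by (intro sum_mono divide_left_mono mult_pos_pos) auto
  also have "\<dots> = real (card D) / real m" by simp
  also have "\<dots> \<le> 3" using card m0 by (simp add: divide_le_eq)
  finally show "(\<Sum>k\<in>D. 1 / (real k + real Q)) \<le> 3" .
  have "(\<Sum>k\<in>D. 1 / (real k + real Q)\<^sup>2) \<le> (\<Sum>k\<in>D. 1 / (real m)\<^sup>2)"
    using lower m0 den by (intro sum_mono divide_left_mono mult_pos_pos power_mono zero_less_power) auto
  also have "\<dots> = real (card D) / (real m)\<^sup>2" by simp
  also have "\<dots> \<le> 3 * real m / (real m)\<^sup>2" using card by (intro divide_right_mono) auto
  also have "\<dots> = 3 / (4 ^ j * real Q)" using m0 by (simp add: power2_eq_square m_def)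
  finally show "(\<Sum>k\<in>D. 1 / (real k + real Q)\<^sup>2) \<le> 3 / (4 ^ j * real Q)" .
qed

lemma geometric_tail_le:
  fixes x :: real
  assumes "0 < x" "x < 1"
  shows "(\<Sum>i=m..n. x ^ i) \<le> x ^ m / (1 - x)"
  using assms by (auto simp: sum_gp divide_right_mono)

lemma sum_large_inverse_powers_le:
  fixes y :: real
  assumes "y > 0"
  shows "(\<Sum>j | j \<le> n \<and> y < 4 ^ j. (1/4::real) ^ j) \<le> (4/3) / y"
proof (cases "\<exists>j. y < 4 ^ j")
  case True
  define m where "m = (LEAST j. y < 4 ^ j)"
  have m: "y < 4 ^ m" unfolding m_def using True by (rule LeastI_ex)
  have "(\<Sum>j | j \<le> n \<and> y < 4 ^ j. (1/4::real) ^ j) \<le> (\<Sum>j=m..n. (1/4::real) ^ j)"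
    by (intro sum_mono2) (auto simp: m_def intro: Least_le)
  also have "\<dots> \<le> (1/4) ^ m / (1 - 1/4)" by (rule geometric_tail_le) auto
  also have "\<dots> = (4/3) * (1 / 4 ^ m)" by (simp add: power_divide)
  also have "\<dots> \<le> (4/3) * (1 / y)"
    using m assms by (intro mult_left_mono divide_left_mono) auto
  finally show ?thesis by simp
qed (use assms in simp)

text \<open>
  Since \<open>|exp (- z) - 1| \<le> |z|\<close> in the right half-plane, the correction is at most
  \<open>\<epsilon> \<Sum> |h\<^sub>i|\<close>; the bound is then the triangle inequality in mean square, obtained from the
  Cauchy--Schwarz inequality with the weights \<open>r\<^sub>i\<close>.
\<close>
lemma correction_l2_bound:
  fixes h :: "nat \<Rightarrow> real \<Rightarrow> complex" and r :: "nat \<Rightarrow> real"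
  assumes \<epsilon>: "\<epsilon> > 0"
    and cont: "\<And>i. continuous_on {a..b} (h i)"
    and Re: "\<And>i t. t \<in> {a..b} \<Longrightarrow> 0 \<le> Re (h i t)"
    and l2: "\<And>i. integral {a..b} (\<lambda>t. (norm (h i t))\<^sup>2) \<le> B * (r i)\<^sup>2"
    and r: "\<And>i. r i > 0" and B: "B \<ge> 0"
  shows "integral {a..b} (\<lambda>t. (norm (exp (- (of_real \<epsilon> * (\<Sum>i\<in>A. h i t))) - 1))\<^sup>2) \<le> B * (\<epsilon> * (\<Sum>i\<in>A. r i))\<^sup>2"
proof -
  define s where "s = (\<Sum>i\<in>A. r i)"
  have r_nz: "r i \<noteq> 0" for i using r[of i] by simp
  have s0: "s \<ge> 0" unfolding s_def by (intro sum_nonneg) (use r in \<open>auto intro: less_imp_le\<close>)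
  have "integral {a..b} (\<lambda>t. (norm (exp (- (of_real \<epsilon> * (\<Sum>i\<in>A. h i t))) - 1))\<^sup>2)
     \<le> integral {a..b} (\<lambda>t. \<Sum>i\<in>A. (\<epsilon>\<^sup>2 * s / r i) * (norm (h i t))\<^sup>2)"
  proof (intro integral_le integrable_continuous_interval continuous_intros cont)
    fix t assume t: "t \<in> {a..b}"
    have "norm (exp (- (of_real \<epsilon> * (\<Sum>i\<in>A. h i t))) - 1) \<le> norm (of_real \<epsilon> * (\<Sum>i\<in>A. h i t))"
      using Re[OF t] \<epsilon> by (intro norm_exp_minus_one_le) (auto simp: Re_sum intro!: mult_nonneg_nonneg sum_nonneg)
    also have "\<dots> = \<epsilon> * norm (\<Sum>i\<in>A. h i t)" using \<epsilon> by (simp add: norm_mult)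
    also have "\<dots> \<le> \<epsilon> * (\<Sum>i\<in>A. norm (h i t))" using \<epsilon> by (intro mult_left_mono norm_sum) auto
    finally have "(norm (exp (- (of_real \<epsilon> * (\<Sum>i\<in>A. h i t))) - 1))\<^sup>2 \<le> (\<epsilon> * (\<Sum>i\<in>A. norm (h i t)))\<^sup>2"
      by (intro power_mono) auto
    also have "\<dots> = \<epsilon>\<^sup>2 * (\<Sum>i\<in>A. sqrt (r i) * (norm (h i t) / sqrt (r i)))\<^sup>2"
      using r by (simp add: power_mult_distrib less_imp_neq[THEN not_sym])
    also have "\<dots> \<le> \<epsilon>\<^sup>2 * ((\<Sum>i\<in>A. (sqrt (r i))\<^sup>2) * (\<Sum>i\<in>A. (norm (h i t) / sqrt (r i))\<^sup>2))"
      by (intro mult_left_mono Cauchy_Schwarz_ineq_sum) auto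
    also have "\<dots> = (\<Sum>i\<in>A. (\<epsilon>\<^sup>2 * s / r i) * (norm (h i t))\<^sup>2)"
      using r by (simp add: s_def power_divide less_imp_le sum_distrib_left mult_ac)
    finally show "(norm (exp (- (of_real \<epsilon> * (\<Sum>i\<in>A. h i t))) - 1))\<^sup>2 \<le> \<dots>" .
  qed
  also have "\<dots> = (\<Sum>i\<in>A. (\<epsilon>\<^sup>2 * s / r i) * integral {a..b} (\<lambda>t. (norm (h i t))\<^sup>2))"
  proof (cases "finite A")
    case True
    then show ?thesis
      by (subst integral_sum) (auto intro!: integrable_continuous_interval continuous_intros cont simp: r_nz)
  qed simp
  also have "\<dots> \<le> (\<Sum>i\<in>A. (\<epsilon>\<^sup>2 * s / r i) * (B * (r i)\<^sup>2))"
    using r s0 by (intro sum_mono mult_left_mono l2) (auto intro!: divide_nonneg_pos)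
  also have "\<dots> = (\<Sum>i\<in>A. (\<epsilon>\<^sup>2 * s * B) * r i)"
    using r by (intro sum.cong) (auto simp: power2_eq_square less_imp_neq[THEN not_sym])
  also have "\<dots> = B * (\<epsilon> * s)\<^sup>2" unfolding sum_distrib_left[symmetric] s_def[symmetric]
    by (simp add: power2_eq_square)
  finally show ?thesis unfolding s_def .
qed

lemma weighted_l1_le_l2:
  fixes f G :: "real \<Rightarrow> complex"
  assumes "continuous_on {a..b} f" "continuous_on {a..b} G" "\<tau> > 0"
  shows "integral {a..b} (\<lambda>t. norm (f t) * norm (G t))
    \<le> (\<tau> * integral {a..b} (\<lambda>t. (norm (f t))\<^sup>2) + (1 / \<tau>) * integral {a..b} (\<lambda>t. (norm (G t))\<^sup>2)) / 2"
proof -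
  note [continuous_intros] = assms(1,2)
  have "integral {a..b} (\<lambda>t. norm (f t) * norm (G t))
    \<le> integral {a..b} (\<lambda>t. (\<tau> / 2) * (norm (f t))\<^sup>2 + (1 / (2 * \<tau>)) * (norm (G t))\<^sup>2)"
  proof (intro integral_le integrable_continuous_interval continuous_intros)
    fix t
    have "0 \<le> (1 / (2 * \<tau>)) * (\<tau> * norm (f t) - norm (G t))\<^sup>2" using assms(3) by simp
    also have "\<dots> = (\<tau> / 2) * (norm (f t))\<^sup>2 + (1 / (2 * \<tau>)) * (norm (G t))\<^sup>2 - norm (f t) * norm (G t)"
      using assms(3) by (simp add: power2_eq_square field_simps)
    finally show "norm (f t) * norm (G t) \<le> (\<tau> / 2) * (norm (f t))\<^sup>2 + (1 / (2 * \<tau>)) * (norm (G t))\<^sup>2" by simp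
  qed
  also have "\<dots> = integral {a..b} (\<lambda>t. (\<tau> / 2) * (norm (f t))\<^sup>2) + integral {a..b} (\<lambda>t. (1 / (2 * \<tau>)) * (norm (G t))\<^sup>2)"
    by (intro integral_add integrable_continuous_interval continuous_intros)
  finally show ?thesis by (simp add: add_divide_distrib)
qed

section \<open>The test function\<close>

text \<open>
  The pairings with \<open>F\<close> are those of \<open>\<Sum> w\<^sub>l e(\<lambda>\<^sub>l t)\<close> up to an error of the size of the weights
  times \<open>\<epsilon>\<close>, while \<open>F\<close> is bounded by \<open>2 / \<epsilon>\<close>.
\<close>
lemma test_function_exists:
  fixes N R :: nat and w :: "nat \<Rightarrow> complex" and lam :: "nat \<Rightarrow> real"
  assumes L: "1 \<le> L" "L \<le> 2" and \<epsilon>: "0 < \<epsilon>" "3 * \<epsilon> \<le> 1" and R: "R \<ge> 1"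
    and Q: "Q = (real R)\<^sup>2"
    and sep: "\<And>k l. l \<le> k \<Longrightarrow> k \<le> N \<Longrightarrow> real k - real l \<le> lam k - lam l"
    and w: "\<And>l. norm (w l) \<le> 1 / (real l + Q)"
  shows "\<exists>F :: real \<Rightarrow> complex. continuous_on UNIV F \<and>
    (\<forall>t\<in>{-L/2..L/2}. norm (F t) \<le> 2 / \<epsilon>) \<and>
    (\<forall>k\<le>N. norm (integral {-L/2..L/2} (\<lambda>t. of_real (cos (pi * t / L)) * (F t * e1 (- lam k * t)))
         - (\<Sum>l\<le>N. w l * window_ft L (lam l + - lam k))) \<le> 1600 * \<epsilon> / (real k + Q))"
proof -
  let ?I = "{-L/2..L/2}"
  have L0: "L > 0" using L by simp
  define Qn where "Qn = R\<^sup>2"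
  have Qn: "Qn \<ge> 1" "Q = real Qn" using R by (auto simp: Qn_def Q)
  have Q1: "Q \<ge> 1" using Qn by simp
  have abs_sep: "\<bar>real k - real l\<bar> \<le> \<bar>lam k - lam l\<bar>" if "k \<le> N" "l \<le> N" for k l
    using sep[of k l] sep[of l k] that by (cases "k \<le> l") auto
  obtain blk :: "nat \<Rightarrow> nat" where blk: "\<And>k. blk k \<le> k"
    "\<And>k. 4 ^ blk k * Qn \<le> k + Qn" "\<And>k. k + Qn < 4 ^ (blk k + 1) * Qn"
    using quaternary_blocks[OF Qn(1)] by blast
  define r where "r j = 1 / (2 ^ j * real R)" for j :: nat
  have r0: "r j > 0" for j using R by (simp add: r_def)
  have r2: "(r j)\<^sup>2 = (1/4) ^ j / Q" for j
  proof -
    have "((2::real) ^ j)\<^sup>2 = (2\<^sup>2) ^ j" by (simp only: power_mult[symmetric] mult.commute)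
    hence "((2::real) ^ j)\<^sup>2 = 4 ^ j" by simp
    thus ?thesis by (simp add: r_def Q power_divide power_mult_distrib)
  qed
  define c where "c j l = (if blk l = j then w l else 0)" for j l
  define f where "f j t = (\<Sum>l\<le>N. c j l * e1 (lam l * t))" for j t
  have c1: "(\<Sum>l\<le>N. norm (c j l)) \<le> 3" for j
  proof -
    have "(\<Sum>l\<le>N. norm (c j l)) = (\<Sum>l | l \<le> N \<and> blk l = j. norm (w l))"
      by (rule sum.mono_neutral_cong_right) (auto simp: c_def)
    also have "\<dots> \<le> (\<Sum>l | l \<le> N \<and> blk l = j. 1 / (real l + real Qn))"
      using w by (intro sum_mono) (simp add: Qn)
    also have "\<dots> \<le> 3" by (rule block_sums_le(1)[OF Qn(1), of _ j]) (use blk in auto)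
    finally show ?thesis .
  qed
  have c2: "(\<Sum>l\<le>N. (norm (c j l))\<^sup>2) \<le> 3 * (r j)\<^sup>2" for j
  proof -
    have "(\<Sum>l\<le>N. (norm (c j l))\<^sup>2) = (\<Sum>l | l \<le> N \<and> blk l = j. (norm (w l))\<^sup>2)"
      by (rule sum.mono_neutral_cong_right) (auto simp: c_def)
    also have "\<dots> \<le> (\<Sum>l | l \<le> N \<and> blk l = j. 1 / (real l + real Qn)\<^sup>2)"
    proof (intro sum_mono)
      fix l show "(norm (w l))\<^sup>2 \<le> 1 / (real l + real Qn)\<^sup>2"
        using power_mono[OF w[of l] norm_ge_zero, of 2] by (simp add: Qn power_divide)
    qed
    also have "\<dots> \<le> 3 / (4 ^ j * real Qn)" by (rule block_sums_le(2)[OF Qn(1)]) (use blk in auto)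
    also have "\<dots> = 3 * (r j)\<^sup>2" by (simp add: r2 Qn power_divide)
    finally show ?thesis .
  qed
  have cf: "continuous_on S (f j)" for S j unfolding f_def by (intro continuous_intros)
  have f3: "norm (f j t) \<le> 3" for j t
  proof -
    have "norm (f j t) \<le> (\<Sum>l\<le>N. norm (c j l))"
      unfolding f_def by (rule sum_norm_le) (simp add: norm_mult)
    thus ?thesis using c1[of j] by linarith
  qed
  have f2: "integral ?I (\<lambda>t. (norm (f j t))\<^sup>2) \<le> 15 * (r j)\<^sup>2" for j
  proof -
    have "integral ?I (\<lambda>t. (norm (f j t))\<^sup>2) \<le> 5 * (\<Sum>l\<le>N. (norm (c j l))\<^sup>2)"
      unfolding f_def by (rule exponential_sum_l2_bound[OF L0 L(2) abs_sep])
    also have "\<dots> \<le> 5 * (3 * (r j)\<^sup>2)" using c2[of j] by simp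
    finally show ?thesis by simp
  qed
  have fsum: "(\<Sum>j\<le>N. f j t) = (\<Sum>l\<le>N. w l * e1 (lam l * t))" for t
  proof -
    have "(\<Sum>j\<le>N. f j t) = (\<Sum>l\<le>N. \<Sum>j\<le>N. c j l * e1 (lam l * t))"
      unfolding f_def by (rule sum.swap)
    also have "\<dots> = (\<Sum>l\<le>N. w l * e1 (lam l * t))"
    proof (intro sum.cong refl)
      fix l assume "l \<in> {..N}"
      hence "blk l \<in> {..N}" using blk(1)[of l] by simp
      thus "(\<Sum>j\<le>N. c j l * e1 (lam l * t)) = w l * e1 (lam l * t)"
        by (simp add: c_def if_distrib[where f = "\<lambda>x. x * _"] cong: if_cong)
    qed
    finally show ?thesis .
  qed
  have "\<exists>q :: complex poly. (\<forall>z. poly q (cnj z) = cnj (poly q z)) \<and>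
      (\<forall>t\<in>?I. norm (f j t) \<le> Re (poly q (circ L t)) \<and> Re (poly q (circ L t)) \<le> norm (f j t) + 2 * r j)" for j
  proof -
    have "continuous_on ?I (\<lambda>t. norm (f j t))" by (intro continuous_intros cf)
    from one_sided_majorant[OF L0 r0[of j] this] obtain q :: "complex poly" where
      "\<And>z. poly q (cnj z) = cnj (poly q z)"
      "\<And>t. t \<in> ?I \<Longrightarrow> norm (f j t) \<le> Re (poly q (circ L t))"
      "\<And>t. t \<in> ?I \<Longrightarrow> Re (poly q (circ L t)) \<le> norm (f j t) + 2 * r j" by metis
    thus ?thesis by blast
  qed
  then obtain q :: "nat \<Rightarrow> complex poly" where q1: "\<And>j z. poly (q j) (cnj z) = cnj (poly (q j) z)"
    and q2: "\<And>j t. t \<in> ?I \<Longrightarrow> norm (f j t) \<le> Re (poly (q j) (circ L t))"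
    and q3: "\<And>j t. t \<in> ?I \<Longrightarrow> Re (poly (q j) (circ L t)) \<le> norm (f j t) + 2 * r j"
    by metis
  define h where "h j t = poly (q j) (circ L t)" for j t
  have ch: "continuous_on S (h j)" for S j unfolding h_def by (intro continuous_intros L0)
  have h2: "integral ?I (\<lambda>t. (norm (h j t))\<^sup>2) \<le> 92 * (r j)\<^sup>2" for j
  proof -
    have "integral ?I (\<lambda>t. (norm (h j t))\<^sup>2) \<le> 2 * integral ?I (\<lambda>t. (Re (h j t))\<^sup>2)"
      unfolding h_def by (rule one_sided_l2_le_real_part[OF L0 q1])
    also have "integral ?I (\<lambda>t. (Re (h j t))\<^sup>2) \<le> integral ?I (\<lambda>t. 2 * (norm (f j t))\<^sup>2 + 8 * (r j)\<^sup>2)"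
    proof (intro integral_le integrable_continuous_interval continuous_intros cf ch)
      fix t assume t: "t \<in> ?I"
      have "0 \<le> Re (h j t)" using q2[OF t, of j] norm_ge_zero[of "f j t"] unfolding h_def by linarith
      hence "(Re (h j t))\<^sup>2 \<le> (norm (f j t) + 2 * r j)\<^sup>2"
        using q3[OF t, of j] by (intro power_mono) (auto simp: h_def)
      also have "\<dots> \<le> 2 * (norm (f j t))\<^sup>2 + 8 * (r j)\<^sup>2"
        using zero_le_power2[of "norm (f j t) - 2 * r j"] by (simp add: power2_eq_square algebra_simps)
      finally show "(Re (h j t))\<^sup>2 \<le> 2 * (norm (f j t))\<^sup>2 + 8 * (r j)\<^sup>2" .
    qed
    also have "\<dots> = 2 * integral ?I (\<lambda>t. (norm (f j t))\<^sup>2) + L * (8 * (r j)\<^sup>2)"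
      using L0 by (subst integral_add) (auto intro!: integrable_continuous_interval continuous_intros cf)
    also have "\<dots> \<le> 2 * (15 * (r j)\<^sup>2) + 2 * (8 * (r j)\<^sup>2)"
      using f2[of j] L by (intro add_mono mult_left_mono mult_right_mono) auto
    finally show ?thesis by simp
  qed
  have rsum: "(\<Sum>i\<in>{j<..N}. r i) \<le> r j" for j
  proof -
    have "(\<Sum>i\<in>{j<..N}. r i) = (1 / real R) * (\<Sum>i=Suc j..N. (1/2) ^ i)"
      by (simp add: r_def sum_distrib_left power_divide atLeastSucAtMost_greaterThanAtMost mult.commute)
    also have "\<dots> \<le> (1 / real R) * ((1/2) ^ Suc j / (1 - 1/2))"
      by (intro mult_left_mono geometric_tail_le) auto
    also have "\<dots> = r j" by (simp add: r_def power_divide)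
    finally show ?thesis .
  qed
  \<comment> \<open>\<open>1 + G j\<close> is the damping factor of block \<open>j\<close>. It is small in mean square relative to the later
    blocks only, which sum like a geometric series dominated by \<open>r j\<close>.\<close>
  define H where "H j t = (\<Sum>i\<in>{j<..N}. h i t)" for j t
  define G where "G j t = exp (- (of_real \<epsilon> * H j t)) - 1" for j t
  have cG: "continuous_on S (G j)" for S j unfolding G_def H_def by (intro continuous_intros ch)
  have G2: "integral ?I (\<lambda>t. (norm (G j t))\<^sup>2) \<le> 92 * (\<epsilon> * r j)\<^sup>2" for j
  proof -
    have "integral ?I (\<lambda>t. (norm (G j t))\<^sup>2) \<le> 92 * (\<epsilon> * (\<Sum>i\<in>{j<..N}. r i))\<^sup>2"
      unfolding G_def H_def
    proof (rule correction_l2_bound[OF \<epsilon>(1) ch _ h2 r0])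
      fix i t assume t: "t \<in> ?I"
      show "0 \<le> Re (h i t)" using q2[OF t, of i] norm_ge_zero[of "f i t"] unfolding h_def by linarith
    qed auto
    also have "\<dots> \<le> 92 * (\<epsilon> * r j)\<^sup>2"
      using rsum[of j] \<epsilon> r0 by (intro mult_left_mono power_mono) (auto intro!: mult_nonneg_nonneg sum_nonneg less_imp_le[OF r0])
    finally show ?thesis .
  qed
  have G1: "integral ?I (\<lambda>t. norm (G j t)) \<le> 47 * \<epsilon> * r j" for j
  proof -
    have er: "\<epsilon> * r j > 0" using \<epsilon> r0 by simp
    have "integral ?I (\<lambda>t. norm (1::complex) * norm (G j t)) \<le>
       ((\<epsilon> * r j) * integral ?I (\<lambda>t. (norm (1::complex))\<^sup>2) + (1 / (\<epsilon> * r j)) * integral ?I (\<lambda>t. (norm (G j t))\<^sup>2)) / 2"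
      by (rule weighted_l1_le_l2[OF _ cG er]) (intro continuous_intros)
    also have "\<dots> \<le> ((\<epsilon> * r j) * 2 + (1 / (\<epsilon> * r j)) * (92 * (\<epsilon> * r j)\<^sup>2)) / 2"
      using er L L0 G2[of j] by (intro divide_right_mono add_mono mult_left_mono) auto
    also have "\<dots> = 47 * \<epsilon> * r j" using er by (simp add: power2_eq_square)
    finally show ?thesis by simp
  qed
  have GJ: "(1 / (2 * L)) * integral {-L/2..3*L/2} (\<lambda>t. norm (G j t)) \<le> 47 * \<epsilon> * r j" for j
  proof -
    have sym: "H j (L - t) = cnj (H j t)" for t
      using L0 by (simp add: H_def h_def circ_reflect q1 cnj_sum)
    have "norm (G j (L - t)) = norm (cnj (G j t))" for t
      by (simp only: G_def sym) (simp add: exp_cnj)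
    hence "integral {-L/2..3*L/2} (\<lambda>t. norm (G j t)) = 2 * integral ?I (\<lambda>t. norm (G j t))"
      by (intro integral_reflection_symmetric[OF L0] continuous_intros cG) simp
    hence "(1 / (2 * L)) * integral {-L/2..3*L/2} (\<lambda>t. norm (G j t)) = (1 / L) * integral ?I (\<lambda>t. norm (G j t))"
      by simp
    also have "\<dots> \<le> 1 * integral ?I (\<lambda>t. norm (G j t))"
      using L by (intro mult_right_mono integral_nonneg integrable_continuous_interval continuous_intros cG) auto
    finally show ?thesis using G1[of j] by simp
  qed
  define F where "F t = (\<Sum>j\<le>N. f j t * exp (- (of_real \<epsilon> * H j t)))" for t
  have cF: "continuous_on S F" for S unfolding F_def H_def by (intro continuous_intros cf ch)
  have bF: "norm (F t) \<le> 2 / \<epsilon>" if t: "t \<in> ?I" for t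
    unfolding F_def H_def
    by (rule corrected_sum_bounded[OF \<epsilon> f3]) (use q2[OF t] in \<open>simp add: h_def\<close>)
  have F: "F t = (\<Sum>l\<le>N. w l * e1 (lam l * t)) + (\<Sum>j\<le>N. f j t * G j t)" for t
    unfolding F_def fsum[symmetric] sum.distrib[symmetric] by (simp add: G_def algebra_simps)
  have main: "norm (integral ?I (\<lambda>t. of_real (cos (pi * t / L)) * (F t * e1 (- lam k * t)))
         - (\<Sum>l\<le>N. w l * window_ft L (lam l + - lam k))) \<le> 1600 * \<epsilon> / (real k + Q)"
    if k: "k \<le> N" for k
  proof -
    define y where "y = real k + Q"
    have y0: "y > 0" using Q1 by (simp add: y_def)
    define v where "v t = of_real (cos (pi * t / L)) * e1 (- lam k * t)" for t
    have cv: "continuous_on S v" for S unfolding v_def by (intro continuous_intros) (use L0 in auto)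
    have nv: "norm (v t) \<le> 1" for t by (simp add: v_def norm_mult)
    define err where "err j = integral ?I (\<lambda>t. v t * (f j t * G j t))" for j
    have "integral ?I (\<lambda>t. of_real (cos (pi * t / L)) * (F t * e1 (- lam k * t)))
      = integral ?I (\<lambda>t. of_real (cos (pi * t / L)) * ((\<Sum>l\<le>N. w l * e1 (lam l * t)) * e1 (- lam k * t))
           + (\<Sum>j\<le>N. v t * (f j t * G j t)))"
      by (intro integral_cong) (simp add: F v_def sum_distrib_left sum_distrib_right algebra_simps)
    also have "\<dots> = integral ?I (\<lambda>t. of_real (cos (pi * t / L)) * ((\<Sum>l\<le>N. w l * e1 (lam l * t)) * e1 (- lam k * t)))
           + integral ?I (\<lambda>t. \<Sum>j\<le>N. v t * (f j t * G j t))"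
      using L0 by (intro integral_add integrable_continuous_interval continuous_intros cv cf cG) auto
    also have "integral ?I (\<lambda>t. \<Sum>j\<le>N. v t * (f j t * G j t)) = (\<Sum>j\<le>N. err j)"
      unfolding err_def by (intro integral_sum integrable_continuous_interval continuous_intros cv cf cG) auto
    finally have eq: "integral ?I (\<lambda>t. of_real (cos (pi * t / L)) * (F t * e1 (- lam k * t)))
         - (\<Sum>l\<le>N. w l * window_ft L (lam l + - lam k)) = (\<Sum>j\<le>N. err j)"
      unfolding gram_expansion[OF L0] by simp
    \<comment> \<open>In mean square the factors are of size \<open>r j\<close> and \<open>\<epsilon> * r j\<close>. This suffices as soon as \<open>(r j)\<^sup>2\<close>
      is of the order of \<open>1 / y\<close> or smaller.\<close>
    have near: "norm (err j) \<le> 54 * \<epsilon> * (r j)\<^sup>2" for j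
    proof -
      have "norm (err j) \<le> integral ?I (\<lambda>t. norm (f j t) * norm (G j t))"
        unfolding err_def
      proof (intro integral_norm_bound_integral integrable_continuous_interval continuous_intros cv cf cG)
        fix t
        show "norm (v t * (f j t * G j t)) \<le> norm (f j t) * norm (G j t)"
          using mult_right_mono[OF nv[of t], of "norm (f j t) * norm (G j t)"] by (simp add: norm_mult)
      qed
      also have "\<dots> \<le> (\<epsilon> * integral ?I (\<lambda>t. (norm (f j t))\<^sup>2) + (1 / \<epsilon>) * integral ?I (\<lambda>t. (norm (G j t))\<^sup>2)) / 2"
        by (rule weighted_l1_le_l2[OF cf cG \<epsilon>(1)])
      also have "\<dots> \<le> (\<epsilon> * (15 * (r j)\<^sup>2) + (1 / \<epsilon>) * (92 * (\<epsilon> * r j)\<^sup>2)) / 2"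
        using \<epsilon> f2[of j] G2[of j] by (intro divide_right_mono add_mono mult_left_mono) auto
      also have "\<dots> = (107/2) * (\<epsilon> * (r j)\<^sup>2)" using \<epsilon> by (simp add: power2_eq_square field_simps)
      also have "\<dots> \<le> 54 * (\<epsilon> * (r j)\<^sup>2)" using \<epsilon> by (intro mult_right_mono) auto
      finally show ?thesis by simp
    qed
    \<comment> \<open>When the indices of block \<open>j\<close> are at most a quarter of \<open>y\<close>, the frequency \<open>lam k\<close> exceeds all
      those of \<open>f j * G j\<close> by at least \<open>(3/4) * y\<close>, since \<open>G j\<close> only lowers the frequencies of \<open>f j\<close>.\<close>
    have far: "norm (err j) \<le> (188 * \<epsilon> / y) * r j" if j: "4 ^ (j + 2) * Q \<le> y" for j
    proof -
      have term_le: "norm (integral ?I (\<lambda>t. v t * (e1 (lam l * t) * G j t))) \<le> (4/3) / y * (47 * \<epsilon> * r j)"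
        if l: "l \<le> N" "blk l = j" for l
      proof -
        have "real (l + Qn) < real (4 ^ (blk l + 1) * Qn)" using blk(3)[of l] of_nat_less_iff by blast
        hence "4 * (real l + Q) < 4 ^ (j + 2) * Q" by (simp add: l Qn)
        hence ly: "4 * (real l + Q) < y" using j by linarith
        define X where "X = lam k - lam l"
        have "0 \<le> real l" by simp
        hence "real l - real k < 0" using ly Q1 unfolding y_def by argo
        hence lk: "real l < real k" by simp
        have "real k - real l \<le> X" using sep[of l k] lk k unfolding X_def by simp
        hence X: "(3/4) * y \<le> X" using ly unfolding y_def by argo
        have "4 * (real l + Q) \<ge> 4" using Q1 by simp
        hence X1: "X \<ge> 1" using ly X by linarith
        have "v t * (e1 (lam l * t) * G j t) = of_real (cos (pi * t / L)) * e1 (- X * t) * G j t" for t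
          by (simp add: v_def X_def cis_mult algebra_simps)
        hence "norm (integral ?I (\<lambda>t. v t * (e1 (lam l * t) * G j t)))
          = norm (integral ?I (\<lambda>t. of_real (cos (pi * t / L)) * e1 (- X * t) * G j t))" by (simp only:)
        also have "\<dots> \<le> (1 / X) * ((1 / (2 * L)) * integral {-L/2..3*L/2} (\<lambda>t. norm (G j t)))"
        proof (rule one_sided_pairing[OF L(1) X1 cG])
          fix \<eta> :: real assume \<eta>: "\<eta> > 0"
          define S where "S = smult (- of_real \<epsilon>) (\<Sum>i\<in>{j<..N}. q i)"
          obtain p where p: "\<And>z. norm z = 1 \<Longrightarrow> norm (exp (poly S z) - poly p z) \<le> \<eta>"
            using exp_poly_approx[OF \<eta>, of S] by blast
          have "G j t - poly (p - 1) (circ L t) = exp (poly S (circ L t)) - poly p (circ L t)" for t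
            by (simp add: G_def H_def h_def S_def poly_sum)
          thus "\<exists>q. \<forall>t. norm (G j t - poly q (circ L t)) \<le> \<eta>"
            by (intro exI[of _ "p - 1"] allI) (simp only: p norm_circ)
        qed
        also have "\<dots> \<le> (1 / X) * (47 * \<epsilon> * r j)"
          using X1 GJ[of j] by (intro mult_left_mono) auto
        also have "\<dots> \<le> (4/3) / y * (47 * \<epsilon> * r j)"
        proof (intro mult_right_mono)
          show "1 / X \<le> (4/3) / y" using X X1 y0 by (simp add: field_simps)
        qed (use \<epsilon> r0[of j] in auto)
        finally show ?thesis .
      qed
      have "err j = integral ?I (\<lambda>t. \<Sum>l\<le>N. c j l * (v t * (e1 (lam l * t) * G j t)))"
        unfolding err_def f_def by (intro integral_cong) (simp add: sum_distrib_left sum_distrib_right mult_ac)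
      also have "\<dots> = (\<Sum>l\<le>N. integral ?I (\<lambda>t. c j l * (v t * (e1 (lam l * t) * G j t))))"
        by (intro integral_sum integrable_continuous_interval continuous_intros cv cG) auto
      also have "norm \<dots> \<le> (\<Sum>l\<le>N. norm (c j l) * ((4/3) / y * (47 * \<epsilon> * r j)))"
      proof (intro sum_norm_le)
        fix l assume l: "l \<in> {..N}"
        show "norm (integral ?I (\<lambda>t. c j l * (v t * (e1 (lam l * t) * G j t)))) \<le> norm (c j l) * ((4/3) / y * (47 * \<epsilon> * r j))"
        proof (cases "blk l = j")
          case True
          show ?thesis unfolding integral_mult_right norm_mult
            by (rule mult_left_mono[OF term_le]) (use l True in auto)
        qed (simp add: c_def)
      qed
      also have "\<dots> = (\<Sum>l\<le>N. norm (c j l)) * ((4/3) / y * (47 * \<epsilon> * r j))"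
        by (simp only: sum_distrib_right)
      also have "\<dots> \<le> 3 * ((4/3) / y * (47 * \<epsilon> * r j))"
        using c1[of j] \<epsilon> r0[of j] y0 by (intro mult_right_mono) auto
      also have "\<dots> = (188 * \<epsilon> / y) * r j" by simp
      finally show ?thesis .
    qed
    \<comment> \<open>\<open>A\<close> is the set of blocks that the second estimate does not reach.\<close>
    define A where "A = {j. j \<le> N \<and> y / (16 * Q) < 4 ^ j}"
    have A: "finite A" "A \<subseteq> {..N}" by (auto simp: A_def)
    have "norm (\<Sum>j\<le>N. err j) \<le> (\<Sum>j\<le>N. norm (err j))" by (rule norm_sum)
    also have "\<dots> = (\<Sum>j\<in>{..N}-A. norm (err j)) + (\<Sum>j\<in>A. norm (err j))"
      using A by (intro sum.subset_diff) auto
    also have "(\<Sum>j\<in>A. norm (err j)) \<le> (\<Sum>j\<in>A. 54 * \<epsilon> * (r j)\<^sup>2)"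
      by (intro sum_mono near)
    also have "\<dots> = 54 * \<epsilon> / Q * (\<Sum>j\<in>A. (1/4) ^ j)"
      unfolding sum_distrib_left by (intro sum.cong) (simp_all add: r2)
    also have "\<dots> \<le> 54 * \<epsilon> / Q * ((4/3) / (y / (16 * Q)))"
      unfolding A_def using \<epsilon> Q1 y0 by (intro mult_left_mono sum_large_inverse_powers_le) auto
    also have "\<dots> = 1152 * \<epsilon> / y" using Q1 by simp
    also have "(\<Sum>j\<in>{..N}-A. norm (err j)) \<le> (\<Sum>j\<in>{..N}-A. (188 * \<epsilon> / y) * r j)"
    proof (intro sum_mono far)
      fix j assume "j \<in> {..N}-A"
      hence "4 ^ j \<le> y / (16 * Q)" by (auto simp: A_def)
      thus "4 ^ (j + 2) * Q \<le> y" using Q1 by (simp add: field_simps)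
    qed
    also have "\<dots> \<le> (\<Sum>j\<le>N. (188 * \<epsilon> / y) * r j)"
      using \<epsilon> y0 by (intro sum_mono2) (auto intro!: mult_nonneg_nonneg divide_nonneg_pos less_imp_le[OF r0])
    also have "\<dots> = (188 * \<epsilon> / y) * (\<Sum>j\<le>N. r j)" by (simp only: sum_distrib_left)
    also have "\<dots> \<le> (188 * \<epsilon> / y) * 2"
    proof (intro mult_left_mono)
      have "(\<Sum>j\<le>N. r j) = r 0 + (\<Sum>j\<in>{0<..N}. r j)"
      proof -
        have "{..N} = insert 0 {0<..N}" by auto
        thus ?thesis by simp
      qed
      also have "\<dots> \<le> r 0 + r 0" using rsum[of 0] by simp
      also have "\<dots> \<le> 2" using R by (simp add: r_def field_simps)
      finally show "(\<Sum>j\<le>N. r j) \<le> 2" .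
    qed (use \<epsilon> y0 in auto)
    finally have "norm (\<Sum>j\<le>N. err j) \<le> 188 * \<epsilon> / y * 2 + 1152 * \<epsilon> / y" by simp
    also have "\<dots> = 1528 * \<epsilon> / y" by (simp add: field_simps)
    also have "\<dots> \<le> 1600 * \<epsilon> / y" using \<epsilon> y0 by (intro divide_right_mono) auto
    finally show ?thesis unfolding eq y_def .
  qed
  show ?thesis by (intro exI[of _ F] conjI ballI allI impI cF bF main)
qed

section \<open>The inequality\<close>

text \<open>
  Pairing \<open>f\<close> with the test function for \<open>w\<^sub>k = sgn a\<^sub>k / (k + Q)\<close>. At each \<open>k\<close> the diagonal term
  \<open>2 L / \<pi>\<close> exceeds the off-diagonal sum by at least \<open>\<delta> / 3\<close>, and \<open>\<epsilon> = \<delta> / 9600\<close> makes the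
  error of the test function equal to half of this.
\<close>
lemma weighted_sum_le_l1:
  fixes N R :: nat and a :: "nat \<Rightarrow> complex" and lam :: "nat \<Rightarrow> real"
  assumes \<delta>: "0 < \<delta>" "\<delta> < 1" and R: "1 / \<delta> \<le> real R"
    and sep: "\<And>k l. l \<le> k \<Longrightarrow> k \<le> N \<Longrightarrow> real k - real l \<le> lam k - lam l"
  shows "(\<Sum>k\<le>N. norm (a k) / (real k + (real R)\<^sup>2))
     \<le> 115200 / \<delta>\<^sup>2 * integral {-((1+\<delta>)/2)..(1+\<delta>)/2} (\<lambda>t. norm (\<Sum>k\<le>N. a k * e1 (lam k * t)))"
proof -
  define L where "L = 1 + \<delta>"
  have L: "1 \<le> L" "L \<le> 2" "L > 0" using \<delta> by (auto simp: L_def)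
  let ?I = "{-L/2..L/2}"
  define Q where "Q = (real R)\<^sup>2"
  have "1 < 1 / \<delta>" using \<delta> by simp
  hence R1: "real R \<ge> 1" using R by linarith
  hence R1n: "R \<ge> 1" by simp
  have Q1: "Q \<ge> 1" using R1 by (simp add: Q_def)
  have abs_sep: "\<bar>real k - real l\<bar> \<le> \<bar>lam k - lam l\<bar>" if "k \<le> N" "l \<le> N" for k l
    using sep[of k l] sep[of l k] that by (cases "k \<le> l") auto
  define \<epsilon> where "\<epsilon> = \<delta> / 9600"
  have \<epsilon>: "0 < \<epsilon>" "3 * \<epsilon> \<le> 1" using \<delta> by (auto simp: \<epsilon>_def)
  define w where "w l = sgn (a l) / of_real (real l + Q)" for l
  have w: "norm (w l) \<le> 1 / (real l + Q)" for l
    using Q1 by (simp add: w_def norm_divide norm_sgn del: of_real_add)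
  have "\<exists>F :: real \<Rightarrow> complex. continuous_on UNIV F \<and> (\<forall>t\<in>?I. norm (F t) \<le> 2 / \<epsilon>) \<and>
    (\<forall>k\<le>N. norm (integral ?I (\<lambda>t. of_real (cos (pi * t / L)) * (F t * e1 (- lam k * t)))
         - (\<Sum>l\<le>N. w l * window_ft L (lam l + - lam k))) \<le> 1600 * \<epsilon> / (real k + Q))"
    by (rule test_function_exists[OF L(1,2) \<epsilon> R1n Q_def]) (fact sep, fact w)
  then obtain F where cF: "continuous_on UNIV F" and bF: "\<And>t. t \<in> ?I \<Longrightarrow> norm (F t) \<le> 2 / \<epsilon>"
    and F: "\<And>k. k \<le> N \<Longrightarrow>
      norm (integral ?I (\<lambda>t. of_real (cos (pi * t / L)) * (F t * e1 (- lam k * t)))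
         - (\<Sum>l\<le>N. w l * window_ft L (lam l + - lam k))) \<le> 1600 * \<epsilon> / (real k + Q)"
    by blast
  have cF': "continuous_on S F" for S using cF continuous_on_subset by blast
  define f where "f t = (\<Sum>k\<le>N. a k * e1 (lam k * t))" for t
  have cf: "continuous_on S f" for S unfolding f_def by (intro continuous_intros)
  define T where "T k = integral ?I (\<lambda>t. of_real (cos (pi * t / L)) * (F t * e1 (- lam k * t)))" for k
  define W where "W = (\<Sum>k\<le>N. norm (a k) / (real k + Q))"
  define p where "p k = (\<Sum>l\<in>{..N}-{k}. w l * window_ft L (lam l + - lam k))" for k
  have p: "norm (p k) \<le> 2 / (pi * L) * ((1 + 2 * \<delta> / 3) / (real k + Q))" if k: "k \<le> N" for k
  proof -
    have "norm (p k) \<le> (\<Sum>l\<in>{..N}-{k}. 2 / (pi * L) * (1 / (4 * (real k - real l)\<^sup>2 - 1) * (1 / (real l + Q))))"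
      unfolding p_def
    proof (intro sum_norm_le)
      fix l assume l: "l \<in> {..N}-{k}"
      hence "\<bar>real l - real k\<bar> \<ge> 1" by auto
      from norm_window_ft_le[OF L(1) this, of "lam l + - lam k"] abs_sep[of l k] l k
      have "norm (window_ft L (lam l + - lam k)) \<le> 2 / (pi * L) * (1 / (4 * (real k - real l)\<^sup>2 - 1))"
        by (simp add: power2_commute)
      from mult_mono[OF w[of l] this]
      show "norm (w l * window_ft L (lam l + - lam k)) \<le> 2 / (pi * L) * (1 / (4 * (real k - real l)\<^sup>2 - 1) * (1 / (real l + Q)))"
        using Q1 by (simp add: norm_mult mult_ac)
    qed
    also have "\<dots> = 2 / (pi * L) * (\<Sum>l\<in>{..N}-{k}. 1 / (4 * (real k - real l)\<^sup>2 - 1) * (1 / (real l + Q)))"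
      by (simp only: sum_distrib_left)
    also have "\<dots> \<le> 2 / (pi * L) * ((1 + 2 / (3 * real R)) / (real k + Q))"
      using L R1 by (intro mult_left_mono weighted_row_sum_le[OF _ k Q_def]) auto
    also have "\<dots> \<le> 2 / (pi * L) * ((1 + 2 * \<delta> / 3) / (real k + Q))"
    proof (intro mult_left_mono divide_right_mono add_left_mono)
      have "1 / real R \<le> \<delta>" using R R1 \<delta> by (simp add: field_simps)
      thus "2 / (3 * real R) \<le> 2 * \<delta> / 3" by simp
    qed (use L Q1 in auto)
    finally show ?thesis .
  qed
  have coeff: "\<delta> / 6 / (real k + Q) * norm (a k) \<le> Re (a k * cnj (T k))" if k: "k \<le> N" for k
  proof -
    define y where "y = real k + Q"
    have y: "y > 0" using Q1 by (simp add: y_def)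
    define D where "D = T k - (\<Sum>l\<le>N. w l * window_ft L (lam l + - lam k))"
    have D: "norm D \<le> (\<delta> / 6) / y" using F[OF k] by (simp add: D_def T_def y_def \<epsilon>_def)
    have "(\<Sum>l\<le>N. w l * window_ft L (lam l + - lam k)) = w k * of_real (2 * L / pi) + p k"
      using k L by (simp add: p_def sum.remove[of "{..N}" k] window_ft_0)
    hence Tk: "T k = w k * of_real (2 * L / pi) + p k + D" by (simp add: D_def)
    have aw: "a k * cnj (w k) = of_real (norm (a k) / y)"
    proof -
      have "a k * cnj (sgn (a k)) = of_real (norm (a k))"
      proof (cases "a k = 0")
        case False
        hence "a k * cnj (sgn (a k)) = (a k * cnj (a k)) / of_real (norm (a k))"
          by (simp add: sgn_div_norm scaleR_conv_of_real divide_inverse)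
        also have "\<dots> = of_real (norm (a k))"
          using False by (simp add: complex_norm_square[symmetric] power2_eq_square)
        finally show ?thesis .
      qed simp
      thus ?thesis by (simp add: w_def y_def)
    qed
    have "a k * cnj (T k) = of_real (norm (a k) / y * (2 * L / pi)) + a k * cnj (p k + D)"
      unfolding Tk by (simp add: distrib_left mult.assoc[symmetric] aw)
    hence "Re (a k * cnj (T k)) = norm (a k) / y * (2 * L / pi) + Re (a k * cnj (p k + D))"
      by (simp only: plus_complex.sel Re_complex_of_real)
    moreover have "- (norm (a k) * (2 / (pi * L) * ((1 + 2 * \<delta> / 3) / y) + (\<delta> / 6) / y)) \<le> Re (a k * cnj (p k + D))"
    proof -
      have "norm (a k * cnj (p k + D)) = norm (a k) * norm (p k + D)"
        by (simp only: norm_mult complex_mod_cnj)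
      also have "\<dots> \<le> norm (a k) * (2 / (pi * L) * ((1 + 2 * \<delta> / 3) / y) + (\<delta> / 6) / y)"
        using p[OF k] D unfolding y_def by (intro mult_left_mono norm_triangle_le add_mono) auto
      finally show ?thesis using abs_Re_le_cmod[of "a k * cnj (p k + D)"] by linarith
    qed
    moreover have "norm (a k) * (2 / (pi * L) * ((1 + 2 * \<delta> / 3) / y) + (\<delta> / 6) / y)
        = norm (a k) / y * (2 / (pi * L) * (1 + 2 * \<delta> / 3)) + norm (a k) / y * (\<delta> / 6)"
      using y L by (simp add: field_simps)
    ultimately have "norm (a k) / y * (2 * L / pi - 2 / (pi * L) * (1 + 2 * \<delta> / 3) - \<delta> / 6) \<le> Re (a k * cnj (T k))"
      unfolding right_diff_distrib by linarith
    moreover have "\<delta> / 3 \<le> 2 * L / pi - 2 / (pi * L) * (1 + 2 * \<delta> / 3)"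
    proof -
      have eq: "2 * L / pi - 2 / (pi * L) * (1 + 2 * \<delta> / 3) = 2 / (pi * L) * (L\<^sup>2 - (1 + 2 * \<delta> / 3))"
        using L by (simp add: field_simps power2_eq_square)
      have gap: "(4/3) * \<delta> \<le> L\<^sup>2 - (1 + 2 * \<delta> / 3)"
        by (simp add: L_def power2_eq_square algebra_simps)
      have "2 / (4 * 2) \<le> 2 / (pi * L)"
        using L pi_less_4 by (intro divide_left_mono mult_mono mult_pos_pos) auto
      from mult_mono[OF this gap] have "2 / (4 * 2) * ((4/3) * \<delta>) \<le> 2 / (pi * L) * (L\<^sup>2 - (1 + 2 * \<delta> / 3))"
        using \<delta> L by simp
      thus ?thesis unfolding eq by simp
    qed
    moreover have "norm (a k) / y * (\<delta> / 6) = \<delta> / 6 / (real k + Q) * norm (a k)" by (simp add: y_def algebra_simps)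
    ultimately show ?thesis
      using mult_left_mono[of "\<delta> / 6" "2 * L / pi - 2 / (pi * L) * (1 + 2 * \<delta> / 3) - \<delta> / 6" "norm (a k) / y"] y
      by (simp del: times_divide_eq_left times_divide_eq_right)
  qed
  have "\<delta> / 6 * W = (\<Sum>k\<le>N. \<delta> / 6 / (real k + Q) * norm (a k))"
    by (simp add: W_def sum_distrib_left)
  also have "\<dots> \<le> (\<Sum>k\<le>N. Re (a k * cnj (T k)))" by (intro sum_mono coeff) auto
  also have "\<dots> = Re (\<Sum>k\<le>N. a k * cnj (T k))" by simp
  also have "(\<Sum>k\<le>N. a k * cnj (T k)) = integral ?I (\<lambda>t. of_real (cos (pi * t / L)) * (cnj (F t) * f t))"
  proof -
    have "(\<Sum>k\<le>N. a k * cnj (T k))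
      = (\<Sum>k\<le>N. integral ?I (\<lambda>t. a k * (of_real (cos (pi * t / L)) * (cnj (F t) * e1 (lam k * t)))))"
      unfolding T_def integral_mult_right integral_cnj by (simp add: cis_cnj)
    also have "\<dots> = integral ?I (\<lambda>t. \<Sum>k\<le>N. a k * (of_real (cos (pi * t / L)) * (cnj (F t) * e1 (lam k * t))))"
      using L by (intro integral_sum[symmetric] integrable_continuous_interval continuous_intros cF') auto
    finally show ?thesis by (simp add: f_def sum_distrib_left mult_ac)
  qed
  also have "Re \<dots> \<le> norm \<dots>" by (rule complex_Re_le_cmod)
  also have "\<dots> \<le> integral ?I (\<lambda>t. 2 / \<epsilon> * norm (f t))"
  proof (intro integral_norm_bound_integral integrable_continuous_interval continuous_intros cF' cf)
    fix t assume t: "t \<in> ?I"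
    have "\<bar>cos (pi * t / L)\<bar> * (norm (F t) * norm (f t)) \<le> 1 * (2 / \<epsilon> * norm (f t))"
      using bF[OF t] \<epsilon> by (intro mult_mono) auto
    thus "norm (of_real (cos (pi * t / L)) * (cnj (F t) * f t)) \<le> 2 / \<epsilon> * norm (f t)"
      by (simp add: norm_mult)
  qed (use L in auto)
  also have "\<dots> = 19200 / \<delta> * integral ?I (\<lambda>t. norm (f t))"
    by (simp add: \<epsilon>_def)
  finally have "6 / \<delta> * (\<delta> / 6 * W) \<le> 6 / \<delta> * (19200 / \<delta> * integral ?I (\<lambda>t. norm (f t)))"
    using \<delta> by (intro mult_left_mono) auto
  hence "W \<le> 115200 / \<delta>\<^sup>2 * integral ?I (\<lambda>t. norm (f t))" using \<delta> by (simp add: power2_eq_square)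
  moreover have "-L/2 = -((1+\<delta>)/2)" "L/2 = (1+\<delta>)/2" unfolding L_def by linarith+
  ultimately show ?thesis by (simp only: W_def Q_def f_def)
qed

lemma index_gap_le_of_unit_steps:
  fixes lam :: "nat \<Rightarrow> real"
  assumes "\<forall>k<N. lam (k + 1) - lam k \<ge> 1" "l \<le> k" "k \<le> N"
  shows "real k - real l \<le> lam k - lam l"
  using assms(2,3)
proof (induction k rule: dec_induct)
  case (step n)
  thus ?case using assms(1) by (auto dest!: spec[of _ n])
qed simp

theorem theorem4p2:
  shows "\<exists>(c::real) > 0. \<exists>(\<delta>0::real) > 0. \<forall>\<delta>::real. 0 < \<delta> \<and> \<delta> < \<delta>0 \<longrightarrow>
    (\<forall>(N::nat) (lam::nat \<Rightarrow> real) (a::nat \<Rightarrow> complex).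
      (\<forall>k<N. lam k < lam (k + 1)) \<and> (\<forall>k<N. lam (k + 1) - lam k \<ge> 1) \<longrightarrow>
      (\<Sum>k=0..N. cmod (a k) / (real k + 1))
        \<le> c / \<delta> powr (15 / 2) *
          integral {- ((1 + \<delta>) / 2)..(1 + \<delta>) / 2}
            (\<lambda>t::real. cmod (\<Sum>k=0..N. a k * exp (2 * \<i> * of_real pi * of_real (lam k) * of_real t))))"
proof (rule exI[of _ "460800::real"], rule conjI, simp, rule exI[of _ "1::real"], rule conjI, simp, intro allI impI)
  fix \<delta> :: real and N :: nat and lam :: "nat \<Rightarrow> real" and a :: "nat \<Rightarrow> complex"
  assume "0 < \<delta> \<and> \<delta> < 1"
    and hyp: "(\<forall>k<N. lam k < lam (k + 1)) \<and> (\<forall>k<N. lam (k + 1) - lam k \<ge> 1)"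
  hence \<delta>: "0 < \<delta>" "\<delta> < 1" by auto
  define R where "R = nat \<lceil>1 / \<delta>\<rceil>"
  have "1 / \<delta> > 1" using \<delta> by simp
  hence R: "1 / \<delta> \<le> real R" "real R \<le> 2 / \<delta>" "real R \<ge> 1" unfolding R_def by linarith+
  define Q where "Q = (real R)\<^sup>2"
  have Q: "1 \<le> Q" "Q \<le> 4 / \<delta>\<^sup>2"
    using R power_mono[OF R(2), of 2] by (auto simp: Q_def power_divide)
  define J where "J = integral {- ((1 + \<delta>) / 2)..(1 + \<delta>) / 2} (\<lambda>t. cmod (\<Sum>k\<le>N. a k * e1 (lam k * t)))"
  have J0: "J \<ge> 0" unfolding J_def
    by (intro integral_nonneg integrable_continuous_interval continuous_intros) auto
  have "(\<Sum>k=0..N. cmod (a k) / (real k + 1)) \<le> (\<Sum>k\<le>N. Q * (cmod (a k) / (real k + Q)))"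
    unfolding atLeast0AtMost
  proof (intro sum_mono)
    fix k
    have "real k * 1 \<le> real k * Q" using Q by (intro mult_left_mono) auto
    hence "1 / (real k + 1) \<le> Q / (real k + Q)"
      using Q by (simp add: divide_simps) (simp add: algebra_simps)
    from mult_right_mono[OF this, of "cmod (a k)"]
    show "cmod (a k) / (real k + 1) \<le> Q * (cmod (a k) / (real k + Q))" by simp
  qed
  also have "\<dots> = Q * (\<Sum>k\<le>N. cmod (a k) / (real k + Q))" by (simp add: sum_distrib_left)
  also have "\<dots> \<le> Q * (115200 / \<delta>\<^sup>2 * J)"
    using weighted_sum_le_l1[OF \<delta> R(1), of N lam a] index_gap_le_of_unit_steps[of N lam] hyp Q
    unfolding J_def Q_def by (intro mult_left_mono) auto
  also have "\<dots> \<le> 4 / \<delta>\<^sup>2 * (115200 / \<delta>\<^sup>2 * J)"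
    using Q J0 by (intro mult_right_mono) auto
  also have "\<dots> = 460800 * (1 / \<delta> ^ 4) * J" by (simp add: power2_eq_square power4_eq_xxxx)
  also have "\<dots> \<le> 460800 * (1 / \<delta> powr (15/2)) * J"
  proof (intro mult_right_mono mult_left_mono divide_left_mono J0)
    have "\<delta> powr (15/2) \<le> \<delta> powr 4" using \<delta> by (intro powr_mono') auto
    thus "\<delta> powr (15/2) \<le> \<delta> ^ 4" using \<delta> by simp
  qed (use \<delta> in auto)
  finally have "(\<Sum>k=0..N. cmod (a k) / (real k + 1)) \<le> 460800 / \<delta> powr (15/2) * J" by simp
  moreover have "J = integral {- ((1 + \<delta>) / 2)..(1 + \<delta>) / 2}
            (\<lambda>t::real. cmod (\<Sum>k=0..N. a k * exp (2 * \<i> * of_real pi * of_real (lam k) * of_real t)))"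
    unfolding J_def atLeast0AtMost by (simp add: cis_conv_exp mult_ac)
  ultimately show "(\<Sum>k=0..N. cmod (a k) / (real k + 1))
        \<le> 460800 / \<delta> powr (15 / 2) *
          integral {- ((1 + \<delta>) / 2)..(1 + \<delta>) / 2}
            (\<lambda>t::real. cmod (\<Sum>k=0..N. a k * exp (2 * \<i> * of_real pi * of_real (lam k) * of_real t)))"
    by simp
qed

end
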